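(* Let $p,q\ge1$ be integers, $d=p+q$, and let $\Sigma_1\in\mathbb{S}^p_\ge$ and $\Sigma_2\in\mathbb{S}^q_\ge$. Among all $\Sigma=\begin{bmatrix}\Sigma_1&\Psi\\ \Psi^\top&\Sigma_2\end{bmatrix}\in\Gamma(\Sigma_1,\Sigma_2)$, the matrix $\Sigma_m$ (defined in the context): (i) maximizes $d_W(\Sigma,I_d)$; (ii) maximizes $d_W(\Sigma,\Sigma_0)$, where $\Sigma_0=\begin{bmatrix}\Sigma_1&0\\0&\Sigma_2\end{bmatrix}$; (iii) maximizes $\operatorname{tr}(\Psi\Psi^\top)$ and therefore maximizes the RV coefficient $\mathrm{RV}(\Sigma)$.
   Context: $\mathbb{S}^m_{\ge}$ is the set of real symmetric positive semi-definite $m\times m$ matrices. $\Gamma(\Sigma_1,\Sigma_2)$ is the set of all $\Sigma\in\mathbb{S}^{p+q}_{\ge}$ with upper left $p\times p$ diagonal block $\Sigma_1$ and lower right $q\times q$ diagonal block $\Sigma_2$. The squared Bures--Wasserstein distance between $\Sigma,\Xi\in\mathbb{S}^d_\ge$ is $d_W^2(\Sigma,\Xi)=\operatorname{tr}(\Sigma)+\operatorname{tr}(\Xi)-2\operatorname{tr}\bigl((\Sigma^{1/2}\Xi\Sigma^{1/2})^{1/2}\bigr)$, which is the squared 2-Wasserstein distance between $\mathcal{N}_d(0,\Sigma)$ and $\mathcal{N}_d(0,\Xi)$. Eigendecompositions: $\Sigma_j=U_j\Lambda_jU_j^\top$, $j\in\{1,2\}$, with $U_j$ orthogonal and $\Lambda_j$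 diagonal containing the eigenvalues of $\Sigma_j$ in decreasing order (counting multiplicities). The matrix $\Sigma_m$ is $\Sigma_m=\begin{bmatrix}\Sigma_1&\Psi_m\\ \Psi_m^\top&\Sigma_2\end{bmatrix}$ with $\Psi_m=U_1\Lambda_1^{1/2}\Pi\Lambda_2^{1/2}U_2^\top$, where $\Pi\in\mathbb{R}^{p\times q}$ is the $p\times q$ upper left block of $I_d$; it belongs to $\Gamma(\Sigma_1,\Sigma_2)$. The RV coefficient (defined when $\Sigma_1,\Sigma_2$ are non-zero) is $\mathrm{RV}(\Sigma)=\operatorname{tr}(\Psi\Psi^\top)/\bigl(\operatorname{tr}(\Sigma_1^2)\operatorname{tr}(\Sigma_2^2)\bigr)^{1/2}$. *)

theory Defs
  imports Complex_Main "Jordan_Normal_Form.Matrix"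
begin

definition trace_mat :: "real mat \<Rightarrow> real" where
  "trace_mat A = (\<Sum>i<dim_row A. A $$ (i,i))"

definition psd_mats :: "nat \<Rightarrow> real mat set" where
  "psd_mats m = {A \<in> carrier_mat m m. transpose_mat A = A \<and>
     (\<forall>v \<in> carrier_vec m. v \<bullet> (A *\<^sub>v v) \<ge> 0)}"

text \<open>Only meaningful for positive semi-definite arguments, for which the description determines
  a unique matrix.\<close>

definition sqrt_mat :: "real mat \<Rightarrow> real mat" where
  "sqrt_mat A = (THE B. B \<in> psd_mats (dim_row A) \<and> B * B = A)"

definition bw_dist_sq :: "real mat \<Rightarrow> real mat \<Rightarrow> real" where
  "bw_dist_sq A B = trace_mat A + trace_mat B
     - 2 * trace_mat (sqrt_mat (sqrt_mat A * B * sqrt_mat A))"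

definition bw_dist :: "real mat \<Rightarrow> real mat \<Rightarrow> real" where
  "bw_dist A B = sqrt (bw_dist_sq A B)"

text \<open>Blocks of a matrix whose upper left block has \<open>r\<close> rows and \<open>c\<close> columns.\<close>

definition upper_left :: "nat \<Rightarrow> nat \<Rightarrow> 'a mat \<Rightarrow> 'a mat" where
  "upper_left r c A = (case split_block A r c of (A1, A2, A3, A4) \<Rightarrow> A1)"

definition upper_right :: "nat \<Rightarrow> nat \<Rightarrow> 'a mat \<Rightarrow> 'a mat" where
  "upper_right r c A = (case split_block A r c of (A1, A2, A3, A4) \<Rightarrow> A2)"

definition lower_right :: "nat \<Rightarrow> nat \<Rightarrow> 'a mat \<Rightarrow> 'a mat" where
  "lower_right r c A = (case split_block A r c of (A1, A2, A3, A4) \<Rightarrow> A4)"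

definition block_couplings :: "nat \<Rightarrow> nat \<Rightarrow> real mat \<Rightarrow> real mat \<Rightarrow> real mat set" where
  "block_couplings p q S1 S2 =
     {S \<in> psd_mats (p + q). upper_left p p S = S1 \<and> lower_right p p S = S2}"

text \<open>\<open>A = U L U\<^sup>T\<close> with \<open>U\<close> orthogonal (the library's \<open>orthogonal_mat\<close> does not require normalised
  columns) and \<open>L\<close> diagonal; the diagonal of \<open>L\<close> then lists the eigenvalues of \<open>A\<close>
  with multiplicity.\<close>

definition ordered_eigendecomp :: "nat \<Rightarrow> real mat \<Rightarrow> real mat \<Rightarrow> real mat \<Rightarrow> bool" where
  "ordered_eigendecomp m A U L \<longleftrightarrow>
     U \<in> carrier_mat m m \<and> transpose_mat U * U = 1\<^sub>m m \<and> U * transpose_mat U = 1\<^sub>m m \<and>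
     L \<in> carrier_mat m m \<and> diagonal_mat L \<and> sorted_wrt (\<ge>) (diag_mat L) \<and>
     A = U * L * transpose_mat U"

definition psi_max :: "nat \<Rightarrow> nat \<Rightarrow> real mat \<Rightarrow> real mat \<Rightarrow> real mat \<Rightarrow> real mat \<Rightarrow> real mat" where
  "psi_max p q U1 L1 U2 L2 =
     U1 * sqrt_mat L1 * upper_left p q (1\<^sub>m (p + q)) * sqrt_mat L2 * transpose_mat U2"

definition sigma_max :: "nat \<Rightarrow> nat \<Rightarrow> real mat \<Rightarrow> real mat \<Rightarrow> real mat \<Rightarrow> real mat \<Rightarrow> real mat \<Rightarrow> real mat
    \<Rightarrow> real mat" where
  "sigma_max p q S1 S2 U1 L1 U2 L2 =
     four_block_mat S1 (psi_max p q U1 L1 U2 L2) (transpose_mat (psi_max p q U1 L1 U2 L2)) S2"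

definition sq_cross_cov :: "nat \<Rightarrow> real mat \<Rightarrow> real" where
  "sq_cross_cov p S = trace_mat (upper_right p p S * transpose_mat (upper_right p p S))"

definition RV_coeff :: "nat \<Rightarrow> real mat \<Rightarrow> real" where
  "RV_coeff p S = sq_cross_cov p S /
     sqrt (trace_mat (upper_left p p S ^\<^sub>m 2) * trace_mat (lower_right p p S ^\<^sub>m 2))"

end

theory Submission
  imports Defs "Jordan_Normal_Form.Spectral_Radius"
begin

text \<open>Let \<open>\<alpha>\<^sub>k\<close> and \<open>\<beta>\<^sub>k\<close> be the eigenvalues of \<open>S1\<close> and \<open>S2\<close> in decreasing order, continued by
zeros, and put \<open>\<sigma>\<^sub>k = \<alpha>\<^sub>k + \<beta>\<^sub>k\<close>. Everything rests on one comparison of spectra: the eigenvalues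
of any coupling \<open>S\<close> are majorized by \<open>\<sigma>\<close> (\<open>coupling_eigenvalues_majorized\<close>), and the eigenvalues of
\<open>sigma_max\<close> are exactly \<open>\<sigma>\<close>. For the second half, \<open>sigma_max = Z Z\<^sup>T\<close>, where the columns
\<open>(\<surd>\<alpha>\<^sub>k u\<^sub>k, \<surd>\<beta>\<^sub>k w\<^sub>k)\<close> of \<open>Z\<close> are pairwise orthogonal with squared norms \<open>\<sigma>\<^sub>k\<close> (\<open>sigma_max_gram\<close>).

For the first half, write \<open>S = \<Sum>\<^sub>k \<nu>\<^sub>k y\<^sub>k y\<^sub>k\<^sup>T\<close> with orthonormal \<open>y\<^sub>k\<close>, and let \<open>c\<^sub>i\<^sub>k\<close> be the
coordinate of \<open>y\<^sub>k\<close> along the eigenvector \<open>u\<^sub>i\<close> of \<open>S1\<close>. The numbers \<open>\<nu>\<^sub>k c\<^sub>i\<^sub>k\<^sup>2 / \<alpha>\<^sub>i\<close> form a doubly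
substochastic matrix: the sum over \<open>k\<close> is at most 1 because \<open>u\<^sub>i\<^sup>T S1 u\<^sub>i = \<alpha>\<^sub>i\<close>, and the sum over \<open>i\<close> is at
most 1 by a Bessel inequality. Hence \<open>\<Sum>\<^sub>k\<^sub><\<^sub>m \<nu>\<^sub>k (\<Sum>\<^sub>i c\<^sub>i\<^sub>k\<^sup>2) \<le> \<Sum>\<^sub>k\<^sub><\<^sub>m \<alpha>\<^sub>k\<close> (\<open>frame_prefix_bound\<close>).
Adding the same inequality for the second block gives the majorization, since \<open>y\<^sub>k\<close> has norm 1.

All couplings have the same trace, the sum of square roots is Schur-concave, and the sum of
squares is Schur-convex. So \<open>sigma_max\<close> minimizes \<open>tr S\<^sup>1\<^sup>/\<^sup>2\<close> and maximizes \<open>tr S\<^sup>2\<close>. The first fact is the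
claim on the distance to the identity, as \<open>d\<^sup>2(S, I) = tr S + d - 2 tr S\<^sup>1\<^sup>/\<^sup>2\<close>. The second is the claim on the
cross-covariance, as \<open>tr S\<^sup>2 = tr S1\<^sup>2 + tr S2\<^sup>2 + 2 tr \<Psi>\<Psi>\<^sup>T\<close>.

The distance to the independent coupling \<open>S0\<close> reduces to the distance to the identity. With
\<open>R = S0\<^sup>1\<^sup>/\<^sup>2\<close>, the matrices \<open>S\<^sup>1\<^sup>/\<^sup>2 S0 S\<^sup>1\<^sup>/\<^sup>2\<close> and \<open>R S R\<close> are the two Gram matrices of \<open>R S\<^sup>1\<^sup>/\<^sup>2\<close>, so their square
roots have the same trace (\<open>trace_sqrt_swap\<close>). Moreover \<open>R S R\<close> is a coupling of \<open>S1\<^sup>2\<close> and \<open>S2\<^sup>2\<close>,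
and it is the extremal one if \<open>S\<close> is (\<open>sigma_max_congruence\<close>).\<close>

section \<open>Matrix products, traces and blocks\<close>

lemma mult_mat_index:
  assumes "i < dim_row A" "j < dim_col B" "dim_col A = dim_row B"
  shows "(A * B) $$ (i,j) = (\<Sum>k<dim_row B. A $$ (i,k) * B $$ (k,j))"
  using assms by (simp add: scalar_prod_def lessThan_atLeast0)

text \<open>Stated with dimension equations, which the simplifier can discharge, associativity becomes a
rewrite rule for products of rectangular matrices.\<close>

lemma mult_assoc_dim:
  fixes A B C :: "'a::semiring_0 mat"
  assumes "dim_col A = dim_row B" "dim_col B = dim_row C"
  shows "A * B * C = A * (B * C)"
  using assms by (intro assoc_mult_mat) auto

lemma transpose_mult_dim:
  fixes A B :: "'a::comm_semiring_0 mat"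
  assumes "dim_col A = dim_row B"
  shows "transpose_mat (A * B) = transpose_mat B * transpose_mat A"
  using assms by (intro transpose_mult) auto

lemma mult_cancel_mid:
  fixes A B :: "real mat"
  assumes "A * B = 1\<^sub>m n" "dim_col A = dim_row B" "dim_col B = dim_row C" "dim_row C = n"
  shows "A * (B * C) = C"
proof -
  have "A * (B * C) = A * B * C" using assms by (intro mult_assoc_dim[symmetric]) auto
  also have "\<dots> = C" unfolding assms(1) using assms(4) by (intro left_mult_one_mat) auto
  finally show ?thesis .
qed

lemma transpose_mat_diag [simp]: "transpose_mat (mat_diag n f) = mat_diag n f"
  by (rule eq_matI) (auto simp: mat_diag_def)

lemma mat_diag_index [simp]:
  "i < n \<Longrightarrow> j < n \<Longrightarrow> mat_diag n f $$ (i,j) = (if i = j then f i else 0)"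
  "dim_row (mat_diag n f) = n" "dim_col (mat_diag n f) = n"
  by (auto simp: mat_diag_def)

lemma trace_mult:
  assumes "A \<in> carrier_mat n m" "B \<in> carrier_mat m n"
  shows "trace_mat (A * B) = (\<Sum>i<n. \<Sum>j<m. A $$ (i,j) * B $$ (j,i))"
  using assms by (auto simp: trace_mat_def mult_mat_index simp del: index_mult_mat(1))

lemma trace_mult_commute:
  assumes "A \<in> carrier_mat n m" "B \<in> carrier_mat m n"
  shows "trace_mat (A * B) = trace_mat (B * A)"
  unfolding trace_mult[OF assms] trace_mult[OF assms(2,1)]
  by (subst sum.swap) (simp add: mult.commute)

lemma scaled_gram_index:
  fixes Z :: "real mat"
  assumes "Z \<in> carrier_mat n m" "i < n" "j < n"
  shows "(Z * mat_diag m f * transpose_mat Z) $$ (i,j) = (\<Sum>k<m. f k * (Z $$ (i,k) * Z $$ (j,k)))"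
proof -
  have "(Z * mat_diag m f * transpose_mat Z) $$ (i,j)
      = (\<Sum>k<m. (Z * mat_diag m f) $$ (i,k) * Z $$ (j,k))"
    using assms by (subst mult_mat_index) (auto simp del: index_mult_mat(1))
  then show ?thesis
    using assms by (simp add: mat_diag_mult_right[OF assms(1)] algebra_simps)
qed

lemma sum_lessThan_add: "(\<Sum>i<p + q. f i) = (\<Sum>i<p. f i) + (\<Sum>i<q. f (p + i :: nat))"
  for f :: "nat \<Rightarrow> 'a::comm_monoid_add"
  by (induction q) (simp_all add: add.assoc)

lemma block_diag_mult_block_diag:
  fixes A B C D :: "real mat"
  assumes "A \<in> carrier_mat p p" "B \<in> carrier_mat p q" "C \<in> carrier_mat q p" "D \<in> carrier_mat q q"
    "G1 \<in> carrier_mat p p" "G2 \<in> carrier_mat q q" "H1 \<in> carrier_mat p p" "H2 \<in> carrier_mat q q"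
  shows "four_block_mat G1 (0\<^sub>m p q) (0\<^sub>m q p) G2 * four_block_mat A B C D
      * four_block_mat H1 (0\<^sub>m p q) (0\<^sub>m q p) H2
    = four_block_mat (G1 * A * H1) (G1 * B * H2) (G2 * C * H1) (G2 * D * H2)"
proof -
  have "four_block_mat G1 (0\<^sub>m p q) (0\<^sub>m q p) G2 * four_block_mat A B C D
      = four_block_mat (G1 * A) (G1 * B) (G2 * C) (G2 * D)"
    using assms by (subst mult_four_block_mat[of _ p p _ q _ q _ _ p _ q])
      (auto simp: left_add_zero_mat[of _ q] right_add_zero_mat[of _ p] mult_carrier_mat[of _ q q] mult_carrier_mat[of _ p p])
  moreover have "four_block_mat (G1 * A) (G1 * B) (G2 * C) (G2 * D)
      * four_block_mat H1 (0\<^sub>m p q) (0\<^sub>m q p) H2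
      = four_block_mat (G1 * A * H1) (G1 * B * H2) (G2 * C * H1) (G2 * D * H2)"
  proof -
    have c: "G1 * A \<in> carrier_mat p p" "G1 * B \<in> carrier_mat p q" "G2 * C \<in> carrier_mat q p"
      "G2 * D \<in> carrier_mat q q" using assms by (auto intro!: carrier_matI)
    have d: "G1 * A * H1 \<in> carrier_mat p p" "G1 * B * H2 \<in> carrier_mat p q"
      "G2 * C * H1 \<in> carrier_mat q p" "G2 * D * H2 \<in> carrier_mat q q"
      using assms by (auto intro!: carrier_matI)
    show ?thesis
      using assms(5-8)
      by (simp add: mult_four_block_mat[OF c assms(7) zero_carrier_mat zero_carrier_mat assms(8)]
          right_mult_zero_mat[OF c(1)] right_mult_zero_mat[OF c(2)] right_mult_zero_mat[OF c(3)]
          right_mult_zero_mat[OF c(4)] left_add_zero_mat[OF d(2)] left_add_zero_mat[OF d(4)]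
          right_add_zero_mat[OF d(1)] right_add_zero_mat[OF d(3)])
  qed
  ultimately show ?thesis by simp
qed

section \<open>The spectral theorem for real symmetric matrices\<close>

lemma symmetric_bilinear:
  fixes A :: "real mat"
  assumes "A \<in> carrier_mat n n" "transpose_mat A = A" "x \<in> carrier_vec n" "y \<in> carrier_vec n"
  shows "x \<bullet> (A *\<^sub>v y) = y \<bullet> (A *\<^sub>v x)"
proof -
  have "x \<bullet> (A *\<^sub>v y) = (transpose_mat A *\<^sub>v x) \<bullet> y"
    using assms by (metis transpose_vec_mult_scalar)
  also have "\<dots> = y \<bullet> (A *\<^sub>v x)"
    using assms by (metis comm_scalar_prod mult_mat_vec_carrier)
  finally show ?thesis .
qed

lemma scalar_self_pos:
  fixes v :: "real vec"
  assumes "v \<in> carrier_vec n" "v \<noteq> 0\<^sub>v n"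
  shows "v \<bullet> v > 0"
  using conjugate_square_greater_0_vec[OF assms(1)] assms(2) by simp

text \<open>The complexified matrix has an eigenvector \<open>x + i y\<close>; symmetry forces its eigenvalue to be real,
so that \<open>x\<close> and \<open>y\<close> both satisfy the eigenvalue equation and one of them is non-zero.\<close>

lemma symmetric_has_unit_eigenvector:
  fixes A :: "real mat"
  assumes A: "A \<in> carrier_mat n n" and sym: "transpose_mat A = A" and n: "n > 0"
  obtains v a where "v \<in> carrier_vec n" "v \<bullet> v = 1" "A *\<^sub>v v = a \<cdot>\<^sub>v v"
proof -
  let ?A = "map_mat complex_of_real A"
  have "spectrum ?A \<noteq> {}" using spectrum_non_empty[of ?A n] A n by auto
  then obtain c z where ev: "eigenvector ?A z c"
    unfolding spectrum_def eigenvalue_def by auto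
  then have z: "z \<in> carrier_vec n" "z \<noteq> 0\<^sub>v n" and Az: "?A *\<^sub>v z = c \<cdot>\<^sub>v z"
    using A unfolding eigenvector_def by auto
  define x where "x = map_vec Re z"
  define y where "y = map_vec Im z"
  have xy [simp]: "x \<in> carrier_vec n" "y \<in> carrier_vec n" using z by (auto simp: x_def y_def)
  have comp: "c * z $ i = (\<Sum>j<n. of_real (A $$ (i,j)) * z $ j)" if "i < n" for i
  proof -
    have "(?A *\<^sub>v z) $ i = (c \<cdot>\<^sub>v z) $ i" using Az by simp
    then show ?thesis using that A z by (simp add: scalar_prod_def lessThan_atLeast0)
  qed
  have Ax: "A *\<^sub>v x = Re c \<cdot>\<^sub>v x - Im c \<cdot>\<^sub>v y"
  proof (rule eq_vecI)
    fix i assume "i < dim_vec (Re c \<cdot>\<^sub>v x - Im c \<cdot>\<^sub>v y)"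
    then have i: "i < n" using xy(2) by simp
    from arg_cong[OF comp[OF i], of Re]
    show "(A *\<^sub>v x) $ i = (Re c \<cdot>\<^sub>v x - Im c \<cdot>\<^sub>v y) $ i"
      using i A z by (simp add: x_def y_def scalar_prod_def lessThan_atLeast0)
  qed (use A z in \<open>simp add: y_def\<close>)
  have Ay: "A *\<^sub>v y = Im c \<cdot>\<^sub>v x + Re c \<cdot>\<^sub>v y"
  proof (rule eq_vecI)
    fix i assume "i < dim_vec (Im c \<cdot>\<^sub>v x + Re c \<cdot>\<^sub>v y)"
    then have i: "i < n" using xy(2) by simp
    from arg_cong[OF comp[OF i], of Im]
    show "(A *\<^sub>v y) $ i = (Im c \<cdot>\<^sub>v x + Re c \<cdot>\<^sub>v y) $ i"
      using i A z by (simp add: x_def y_def scalar_prod_def lessThan_atLeast0)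
  qed (use A z in \<open>simp add: y_def\<close>)
  have nz: "x \<noteq> 0\<^sub>v n \<or> y \<noteq> 0\<^sub>v n"
  proof (rule ccontr)
    assume "\<not> ?thesis"
    then have "x = 0\<^sub>v n" "y = 0\<^sub>v n" by auto
    then have "Re (z $ i) = 0" "Im (z $ i) = 0" if "i < n" for i
      using that z unfolding x_def y_def by (metis carrier_vecD index_map_vec(1) index_zero_vec(1))+
    then have "z = 0\<^sub>v n" using z by (intro eq_vecI) (auto simp: complex_eq_iff)
    with z show False by simp
  qed
  have "y \<bullet> (A *\<^sub>v x) = x \<bullet> (A *\<^sub>v y)" using symmetric_bilinear A sym xy by blast
  then have "Im c * (x \<bullet> x + y \<bullet> y) = 0"
    unfolding Ax Ay
    using comm_scalar_prod[OF xy]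
    by (simp add: scalar_prod_minus_distrib[of _ n] scalar_prod_add_distrib[of _ n]
        carrier_vecD[OF xy(1)] carrier_vecD[OF xy(2)] algebra_simps)
  moreover have "x \<bullet> x + y \<bullet> y > 0"
    using nz scalar_self_pos[OF xy(1)] scalar_self_pos[OF xy(2)] xy
    by (cases "x = 0\<^sub>v n"; cases "y = 0\<^sub>v n") (auto simp: add_pos_pos)
  ultimately have "Im c = 0" by simp
  then have "A *\<^sub>v x = Re c \<cdot>\<^sub>v x" "A *\<^sub>v y = Re c \<cdot>\<^sub>v y"
    unfolding Ax Ay by (auto intro!: eq_vecI simp: x_def y_def)
  with nz obtain w where w: "w \<in> carrier_vec n" "w \<noteq> 0\<^sub>v n" "A *\<^sub>v w = Re c \<cdot>\<^sub>v w"
    using xy by blast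
  define v where "v = (1 / sqrt (w \<bullet> w)) \<cdot>\<^sub>v w"
  have "w \<bullet> w > 0" using scalar_self_pos w by blast
  show ?thesis
  proof
    show "v \<in> carrier_vec n" using w by (simp add: v_def)
    show "v \<bullet> v = 1" using w(1) \<open>w \<bullet> w > 0\<close>
      by (simp add: v_def)
    show "A *\<^sub>v v = Re c \<cdot>\<^sub>v v"
      using w A by (simp add: v_def mult_mat_vec[OF A] smult_smult_assoc mult.commute)
  qed
qed

text \<open>The reflection that exchanges \<open>v\<close> with the first basis vector \<open>e\<close> is \<open>I - 2 w w\<^sup>T / (w \<bullet> w)\<close>
for \<open>w = v - e\<close>, and \<open>w \<bullet> w = 2 (1 - v\<^sub>0)\<close> since both vectors have norm 1.\<close>

lemma householder_reflection:
  fixes v :: "real vec"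
  assumes v: "v \<in> carrier_vec n" "v \<bullet> v = 1" and n: "n > 0"
  obtains H where "H \<in> carrier_mat n n" "transpose_mat H = H" "H * H = 1\<^sub>m n" "col H 0 = v"
proof -
  define w where "w i = v $ i - (if i = 0 then 1 else 0)" for i
  \<comment> \<open>If \<open>v\<close> is already the first basis vector, then \<open>c = 1 / 0 = 0\<close> and \<open>H\<close> is the identity.\<close>
  define c where "c = 1 / (1 - v $ 0)"
  define H where "H = mat n n (\<lambda>(i,j). (if i = j then 1 else 0) - c * w i * w j)"
  have vv: "(\<Sum>i<n. v $ i * v $ i) = 1"
    using v by (simp add: scalar_prod_def lessThan_atLeast0)
  have ww: "(\<Sum>i<n. w i * w i) = 2 * (1 - v $ 0)"
  proof -
    have "(\<Sum>i<n. w i * w i)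
        = (\<Sum>i<n. v $ i * v $ i - 2 * (if i = 0 then v $ 0 else 0) + (if i = 0 then 1 else 0))"
      by (rule sum.cong) (auto simp: w_def algebra_simps)
    also have "\<dots> = 1 - 2 * v $ 0 + 1"
      unfolding sum.distrib sum_subtractf vv using n
      by (simp add: sum_distrib_left[symmetric] sum.delta)
    finally show ?thesis by simp
  qed
  have cc: "c * c * (2 * (1 - v $ 0)) = 2 * c" 
  proof (cases "v $ 0 = 1")
    case False
    then have "c * (1 - v $ 0) = 1" by (simp add: c_def)
    then show ?thesis by (metis mult.assoc mult.commute mult.right_neutral)
  qed (simp add: c_def)
  have HH: "H * H = 1\<^sub>m n"
  proof (rule eq_matI)
    fix i j assume ij: "i < dim_row (1\<^sub>m n :: real mat)" "j < dim_col (1\<^sub>m n :: real mat)"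
    have "(H * H) $$ (i,j) = (\<Sum>k<n. ((if i = k then 1 else 0) - c * w i * w k) *
        ((if k = j then 1 else 0) - c * w k * w j))"
      using ij by (subst mult_mat_index) (auto simp: H_def)
    also have "\<dots> = (\<Sum>k<n. (if k = i then (if i = j then 1 else 0) else 0)
        - (if k = i then c * w i * w j else 0)
        - (if k = j then c * w i * w j else 0) + (c * c * w i * w j) * (w k * w k))"
      by (rule sum.cong) (auto simp: algebra_simps)
    also have "\<dots> = (if i = j then 1 else 0) - 2 * (c * w i * w j)
        + (c * c * (2 * (1 - v $ 0))) * (w i * w j)"
      unfolding sum.distrib sum_subtractf sum_distrib_left[symmetric] ww using ij by simp
    also have "\<dots> = (1\<^sub>m n :: real mat) $$ (i,j)" unfolding cc using ij by simp
    finally show "(H * H) $$ (i,j) = (1\<^sub>m n :: real mat) $$ (i,j)" .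
  qed (simp_all add: H_def)
  have "col H 0 = v"
  proof (rule eq_vecI)
    fix i assume "i < dim_vec v"
    then have i: "i < n" using v by simp
    show "col H 0 $ i = v $ i"
    proof (cases "v $ 0 = 1")
      case True
      have "(\<Sum>i<n. w i * w i) = 0" using ww True by simp
      then have "w i = 0" using i by (subst (asm) sum_nonneg_eq_0_iff) auto
      then show ?thesis using i n by (auto simp: H_def w_def)
    next
      case False
      then have "c * w 0 = - 1" by (simp add: c_def w_def field_simps)
      have "col H 0 $ i = (if i = 0 then 1 else 0) - (c * w 0) * w i"
        using i n by (simp add: H_def)
      then show ?thesis unfolding \<open>c * w 0 = - 1\<close> by (simp add: w_def)
    qed
  qed (use v in \<open>simp add: H_def\<close>)
  moreover have "transpose_mat H = H" by (rule eq_matI) (auto simp: H_def)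
  moreover have "H \<in> carrier_mat n n" by (simp add: H_def)
  ultimately show ?thesis using HH that by blast
qed

text \<open>Induction by deflation: a reflection carries a unit eigenvector to the first basis vector, and
by symmetry the conjugated matrix then splits off a one-by-one block.\<close>

theorem spectral_symmetric:
  fixes A :: "real mat"
  assumes "A \<in> carrier_mat n n" "transpose_mat A = A"
  shows "\<exists>Y \<nu>. Y \<in> carrier_mat n n \<and> transpose_mat Y * Y = 1\<^sub>m n
    \<and> A = Y * mat_diag n \<nu> * transpose_mat Y"
  using assms
proof (induction n arbitrary: A)
  case 0
  then show ?case by (intro exI[of _ "1\<^sub>m 0"] exI[of _ "\<lambda>_. 0"]) auto
next
  case (Suc n A)
  from symmetric_has_unit_eigenvector[OF Suc.prems] obtain v a
    where v: "v \<in> carrier_vec (Suc n)" "v \<bullet> v = 1" and Av: "A *\<^sub>v v = a \<cdot>\<^sub>v v" by auto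
  from householder_reflection[OF v] obtain H where H: "H \<in> carrier_mat (Suc n) (Suc n)"
    "transpose_mat H = H" "H * H = 1\<^sub>m (Suc n)" and Hv: "col H 0 = v" by auto
  note A = Suc.prems
  define T where "T = H * A * H"
  have T: "T \<in> carrier_mat (Suc n) (Suc n)" using H A by (simp add: T_def)
  note HH = mult_cancel_mid[OF H(3)]
  have symT: "transpose_mat T = T"
    unfolding T_def using A H by (simp add: transpose_mult_dim mult_assoc_dim)
  have AHT: "A = H * T * H"
    unfolding T_def using A H by (simp add: mult_assoc_dim HH)
  have col0: "col T 0 = a \<cdot>\<^sub>v unit_vec (Suc n) 0"
  proof -
    have "col T 0 = H * A *\<^sub>v v" unfolding T_def Hv[symmetric] using H A
      by (subst col_mult2[of _ "Suc n" "Suc n" _ "Suc n"]) auto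
    also have "\<dots> = a \<cdot>\<^sub>v (H *\<^sub>v v)" using H A v Av
      by (simp add: assoc_mult_mat_vec[of _ "Suc n" "Suc n" _ "Suc n"] mult_mat_vec[OF H(1)])
    also have "H *\<^sub>v v = col (H * H) 0" unfolding Hv[symmetric] using H
      by (subst col_mult2[of _ "Suc n" "Suc n" _ "Suc n"]) auto
    also have "\<dots> = unit_vec (Suc n) 0" unfolding H(3) by simp
    finally show ?thesis .
  qed
  have T0: "T $$ (i,0) = (if i = 0 then a else 0)" "T $$ (0,i) = (if i = 0 then a else 0)"
    if "i < Suc n" for i
  proof -
    show 1: "T $$ (i,0) = (if i = 0 then a else 0)"
      using arg_cong[OF col0, of "\<lambda>u. u $ i"] that T by auto
    have "T $$ (0,i) = transpose_mat T $$ (i,0)" using that T by simp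
    then show "T $$ (0,i) = (if i = 0 then a else 0)" unfolding symT 1 .
  qed
  define T' where "T' = mat n n (\<lambda>(i,j). T $$ (Suc i, Suc j))"
  have "T' $$ (j,i) = T' $$ (i,j)" if "i < n" "j < n" for i j
  proof -
    have "transpose_mat T $$ (Suc i, Suc j) = T $$ (Suc j, Suc i)" using that T by simp
    then show ?thesis unfolding symT using that by (simp add: T'_def)
  qed
  then have "T' \<in> carrier_mat n n" "transpose_mat T' = T'"
    by (auto intro!: eq_matI simp: T'_def)
  from Suc.IH[OF this] obtain Y \<nu> where Y: "Y \<in> carrier_mat n n" "transpose_mat Y * Y = 1\<^sub>m n"
    and T'Y: "T' = Y * mat_diag n \<nu> * transpose_mat Y" by auto
  define W where "W = four_block_mat (1\<^sub>m 1) (0\<^sub>m 1 n) (0\<^sub>m n 1) Y"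
  define \<mu> where "\<mu> k = (case k of 0 \<Rightarrow> a | Suc i \<Rightarrow> \<nu> i)" for k
  have D: "mat_diag (Suc n) \<mu> = four_block_mat (mat 1 1 (\<lambda>_. a)) (0\<^sub>m 1 n) (0\<^sub>m n 1) (mat_diag n \<nu>)"
    by (rule eq_matI) (auto simp: \<mu>_def mat_diag_def split: nat.split)
  have WT: "transpose_mat W = four_block_mat (1\<^sub>m 1) (0\<^sub>m 1 n) (0\<^sub>m n 1) (transpose_mat Y)"
    unfolding W_def using Y by (subst transpose_four_block_mat[of _ 1 1 _ n _ n]) auto
  have W: "W \<in> carrier_mat (Suc n) (Suc n)"
    using four_block_carrier_mat[of "1\<^sub>m 1" 1 1 Y n n] Y by (simp add: W_def)
  have WW: "transpose_mat W * W = 1\<^sub>m (Suc n)"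
    unfolding WT unfolding W_def using Y
    by (subst mult_four_block_mat[of _ 1 1 _ n _ n _ _ 1 _ n]) auto
  have "Y * mat_diag n \<nu> * transpose_mat Y \<in> carrier_mat n n"
    using Y by (intro carrier_matI) auto
  note add0 = left_add_zero_mat[OF this]
  have "W * mat_diag (Suc n) \<mu> * transpose_mat W
      = four_block_mat (mat 1 1 (\<lambda>_. a)) (0\<^sub>m 1 n) (0\<^sub>m n 1) T'"
    unfolding WT D unfolding W_def T'Y using Y
    by (subst mult_four_block_mat[of _ 1 1 _ n _ n _ _ 1 _ n],
        simp_all add: mult_four_block_mat[of _ 1 1 _ n _ n _ _ 1 _ n] add0)
  also have "\<dots> = T"
    by (rule eq_matI) (use T in \<open>auto simp: T'_def T0\<close>)
  finally have TW: "T = W * mat_diag (Suc n) \<mu> * transpose_mat W" ..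
  show ?case
  proof (intro exI conjI)
    show "H * W \<in> carrier_mat (Suc n) (Suc n)" using H W by simp
    show "transpose_mat (H * W) * (H * W) = 1\<^sub>m (Suc n)"
      using H W WW by (simp add: transpose_mult_dim mult_assoc_dim HH)
    show "A = H * W * mat_diag (Suc n) \<mu> * transpose_mat (H * W)"
      using H W unfolding AHT TW by (simp add: transpose_mult_dim mult_assoc_dim)
  qed
qed

text \<open>Brings the eigenvalues into decreasing order, as the comparison of partial sums requires.\<close>

lemma sorting_permutation:
  fixes \<nu> :: "nat \<Rightarrow> real"
  obtains \<pi> where "bij_betw \<pi> {..<n} {..<n}" "\<And>i j. i \<le> j \<Longrightarrow> j < n \<Longrightarrow> \<nu> (\<pi> j) \<le> \<nu> (\<pi> i)"
proof
  define xs where "xs = sort_key (\<lambda>k. - \<nu> k) [0..<n]"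
  have xs: "length xs = n" "distinct xs" "set xs = {..<n}"
    by (simp_all add: xs_def lessThan_atLeast0)
  show "bij_betw ((!) xs) {..<n} {..<n}" using xs by (intro bij_betw_nth) auto
  have "sorted (map (\<lambda>k. - \<nu> k) xs)" by (simp add: xs_def)
  then show "\<nu> (xs ! j) \<le> \<nu> (xs ! i)" if "i \<le> j" "j < n" for i j
    using that xs(1) sorted_nth_mono[of "map (\<lambda>k. - \<nu> k) xs" i j] by simp
qed

section \<open>Square roots of positive semi-definite matrices\<close>

lemma psd_matsD:
  assumes "A \<in> psd_mats n"
  shows "A \<in> carrier_mat n n" "transpose_mat A = A" "dim_row A = n" "dim_col A = n"
    "\<And>v. v \<in> carrier_vec n \<Longrightarrow> v \<bullet> (A *\<^sub>v v) \<ge> 0"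
  using assms by (auto simp: psd_mats_def)

lemma gram_psd:
  assumes W: "W \<in> carrier_mat n m"
  shows "W * transpose_mat W \<in> psd_mats n"
proof -
  have "v \<bullet> (W * transpose_mat W *\<^sub>v v) \<ge> 0" if v: "v \<in> carrier_vec n" for v
  proof -
    have "v \<bullet> (W * transpose_mat W *\<^sub>v v) = v \<bullet> (W *\<^sub>v (transpose_mat W *\<^sub>v v))"
      using W v by (subst assoc_mult_mat_vec[of _ n m _ n]) auto
    also have "\<dots> = (transpose_mat W *\<^sub>v v) \<bullet> (transpose_mat W *\<^sub>v v)"
      using W v by (subst transpose_vec_mult_scalar[of _ n m]) auto
    also have "\<dots> \<ge> 0" by (auto simp: scalar_prod_def intro!: sum_nonneg)
    finally show ?thesis .
  qed
  then show ?thesis using W by (auto simp: psd_mats_def transpose_mult_dim)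
qed

lemma scaled_gram_eq_gram:
  fixes Z :: "real mat"
  assumes "Z \<in> carrier_mat n m" "\<And>k. k < m \<Longrightarrow> f k \<ge> 0"
  shows "Z * mat_diag m f * transpose_mat Z
    = (Z * mat_diag m (\<lambda>k. sqrt (f k))) * transpose_mat (Z * mat_diag m (\<lambda>k. sqrt (f k)))"
proof -
  let ?D = "mat_diag m (\<lambda>k. sqrt (f k))"
  have "Z * mat_diag m f = Z * ?D * ?D"
    using assms by (intro eq_matI) (auto simp: mat_diag_mult_right[of _ n m])
  then show ?thesis using assms(1) by (simp add: transpose_mult_dim mult_assoc_dim del: mat_diag_diag)
qed

lemma scaled_gram_psd:
  fixes Z :: "real mat"
  assumes "Z \<in> carrier_mat n m" "\<And>k. k < m \<Longrightarrow> f k \<ge> 0"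
  shows "Z * mat_diag m f * transpose_mat Z \<in> psd_mats n"
proof -
  have "Z * mat_diag m (\<lambda>k. sqrt (f k)) \<in> carrier_mat n m"
    using assms(1) by (intro carrier_matI) auto
  from gram_psd[OF this] show ?thesis using scaled_gram_eq_gram[OF assms] by simp
qed

lemma psd_eigenvalue_nonneg:
  assumes A: "A \<in> psd_mats n" and Y: "Y \<in> carrier_mat n n" "transpose_mat Y * Y = 1\<^sub>m n"
    and AY: "A = Y * mat_diag n \<nu> * transpose_mat Y" and k: "k < n"
  shows "\<nu> k \<ge> 0"
proof -
  note A' = psd_matsD[OF A]
  have "transpose_mat Y * (A * Y) = mat_diag n \<nu>"
    unfolding AY using Y by (simp add: mult_assoc_dim mult_cancel_mid[OF Y(2)])
  then have "\<nu> k = (transpose_mat Y * (A * Y)) $$ (k,k)" using k by simp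
  also have "\<dots> = col Y k \<bullet> col (A * Y) k" using k Y A' by simp
  also have "\<dots> = col Y k \<bullet> (A *\<^sub>v col Y k)"
    using k Y A' by (subst col_mult2[of _ n n _ n]) auto
  also have "\<dots> \<ge> 0" using A'(5) Y k by auto
  finally show ?thesis .
qed

lemma trace_scaled_isometry:
  fixes Y :: "real mat"
  assumes Y: "Y \<in> carrier_mat n m" "transpose_mat Y * Y = 1\<^sub>m m"
  shows "trace_mat (Y * mat_diag m f * transpose_mat Y) = (\<Sum>k<m. f k)"
proof -
  have "trace_mat (Y * mat_diag m f * transpose_mat Y)
      = trace_mat (transpose_mat Y * (Y * mat_diag m f))"
    using Y by (intro trace_mult_commute[of _ n m]) (auto intro!: carrier_matI)
  also have "\<dots> = (\<Sum>k<m. f k)"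
    using Y by (subst mult_cancel_mid[OF Y(2)]) (auto simp: trace_mat_def)
  finally show ?thesis .
qed

lemma mult_scaled_isometry:
  fixes Y :: "real mat"
  assumes Y: "Y \<in> carrier_mat n m" "transpose_mat Y * Y = 1\<^sub>m m"
  shows "(Y * mat_diag m f * transpose_mat Y) * (Y * mat_diag m g * transpose_mat Y)
    = Y * mat_diag m (\<lambda>k. f k * g k) * transpose_mat Y"
  unfolding mat_diag_diag[symmetric]
  using Y(1) by (simp add: mult_assoc_dim mult_cancel_mid[OF Y(2)] del: mat_diag_diag)

theorem spectral_psd:
  assumes A: "A \<in> psd_mats n"
  obtains Y \<nu> where "Y \<in> carrier_mat n n" "transpose_mat Y * Y = 1\<^sub>m n" "Y * transpose_mat Y = 1\<^sub>m n"
    "A = Y * mat_diag n \<nu> * transpose_mat Y"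
    "\<And>i j. i \<le> j \<Longrightarrow> j < n \<Longrightarrow> \<nu> j \<le> \<nu> i" "\<And>i. i < n \<Longrightarrow> \<nu> i \<ge> 0"
proof -
  note A' = psd_matsD[OF A]
  from spectral_symmetric[OF A'(1,2)] obtain X \<mu> where X: "X \<in> carrier_mat n n"
    "transpose_mat X * X = 1\<^sub>m n" and AX: "A = X * mat_diag n \<mu> * transpose_mat X" by auto
  obtain \<pi> where \<pi>: "bij_betw \<pi> {..<n} {..<n}"
    and \<pi>_anti: "\<And>i j. i \<le> j \<Longrightarrow> j < n \<Longrightarrow> \<mu> (\<pi> j) \<le> \<mu> (\<pi> i)" using sorting_permutation by blast
  have \<pi>n: "\<pi> i < n" if "i < n" for i using that \<pi> by (auto simp: bij_betw_def)
  have \<pi>inj: "\<pi> i = \<pi> j \<longleftrightarrow> i = j" if "i < n" "j < n" for i j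
    using that \<pi> by (auto simp: bij_betw_def inj_on_def)
  define Y where "Y = mat n n (\<lambda>(i,k). X $$ (i, \<pi> k))"
  define \<nu> where "\<nu> k = \<mu> (\<pi> k)" for k
  have Y: "Y \<in> carrier_mat n n" by (simp add: Y_def)
  have YY: "transpose_mat Y * Y = 1\<^sub>m n"
  proof (rule eq_matI)
    fix k l assume kl: "k < dim_row (1\<^sub>m n :: real mat)" "l < dim_col (1\<^sub>m n :: real mat)"
    have "(transpose_mat Y * Y) $$ (k,l) = (transpose_mat X * X) $$ (\<pi> k, \<pi> l)"
      using kl X(1) by (simp add: Y_def scalar_prod_def \<pi>n)
    then show "(transpose_mat Y * Y) $$ (k,l) = (1\<^sub>m n :: real mat) $$ (k,l)"
      unfolding X(2) using kl \<pi>n \<pi>inj by simp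
  qed (simp_all add: Y_def)
  have AY: "A = Y * mat_diag n \<nu> * transpose_mat Y"
  proof (rule eq_matI)
    fix i j
    assume "i < dim_row (Y * mat_diag n \<nu> * transpose_mat Y)"
      "j < dim_col (Y * mat_diag n \<nu> * transpose_mat Y)"
    then have ij: "i < n" "j < n" by (simp_all add: Y_def)
    have "A $$ (i,j) = (\<Sum>k<n. \<mu> k * (X $$ (i,k) * X $$ (j,k)))"
      unfolding AX by (rule scaled_gram_index[OF X(1) ij])
    also have "\<dots> = (\<Sum>k<n. \<mu> (\<pi> k) * (X $$ (i,\<pi> k) * X $$ (j,\<pi> k)))"
      by (rule sum.reindex_bij_betw[OF \<pi>, symmetric])
    also have "\<dots> = (Y * mat_diag n \<nu> * transpose_mat Y) $$ (i,j)"
      unfolding scaled_gram_index[OF Y ij] using ij by (simp add: Y_def \<nu>_def)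
    finally show "A $$ (i,j) = (Y * mat_diag n \<nu> * transpose_mat Y) $$ (i,j)" .
  qed (use A' in \<open>simp_all add: Y_def\<close>)
  have "\<nu> k \<ge> 0" if "k < n" for k using psd_eigenvalue_nonneg[OF A Y YY AY that] .
  moreover have "Y * transpose_mat Y = 1\<^sub>m n"
    using mat_mult_left_right_inverse[OF _ Y YY] Y by simp
  moreover have "\<nu> j \<le> \<nu> i" if "i \<le> j" "j < n" for i j using \<pi>_anti that by (simp add: \<nu>_def)
  ultimately show ?thesis using that Y YY AY by blast
qed

text \<open>If \<open>B = Y b Y\<^sup>T\<close> and \<open>C = Z c Z\<^sup>T\<close> have the same square, then \<open>Q = Y\<^sup>T Z\<close> satisfies
\<open>b\<^sup>2 Q = Q c\<^sup>2\<close>. Entrywise, non-negativity of \<open>b\<close> and \<open>c\<close> upgrades this to \<open>b Q = Q c\<close>, which is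
\<open>B = C\<close>. This is what makes the definite description of the square root usable.\<close>

lemma psd_sqrt_unique:
  assumes B: "B \<in> psd_mats n" and C: "C \<in> psd_mats n" and eq: "B * B = C * C"
  shows "B = C"
proof -
  obtain Y b where Y: "Y \<in> carrier_mat n n" "transpose_mat Y * Y = 1\<^sub>m n" "Y * transpose_mat Y = 1\<^sub>m n"
    and BY: "B = Y * mat_diag n b * transpose_mat Y" and b: "\<And>i. i < n \<Longrightarrow> b i \<ge> 0"
    using spectral_psd[OF B] by metis
  obtain Z c where Z: "Z \<in> carrier_mat n n" "transpose_mat Z * Z = 1\<^sub>m n" "Z * transpose_mat Z = 1\<^sub>m n"
    and CZ: "C = Z * mat_diag n c * transpose_mat Z" and c: "\<And>i. i < n \<Longrightarrow> c i \<ge> 0"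
    using spectral_psd[OF C] by metis
  note cancel = mult_cancel_mid[OF Y(2)] mult_cancel_mid[OF Y(3)]
    mult_cancel_mid[OF Z(2)] mult_cancel_mid[OF Z(3)]
  define Q where "Q = transpose_mat Y * Z"
  have Q: "Q \<in> carrier_mat n n" using Y Z by (auto simp: Q_def intro!: carrier_matI)
  have "mat_diag n b * (mat_diag n b * Q) = transpose_mat Y * (B * B) * Z"
    unfolding BY Q_def using Y Z by (simp add: mult_assoc_dim cancel del: mat_diag_diag)
  also have "\<dots> = Q * mat_diag n c * mat_diag n c"
    unfolding eq CZ Q_def using Y Z by (simp add: mult_assoc_dim cancel del: mat_diag_diag)
  finally have intertwine2: "mat_diag n b * (mat_diag n b * Q) = Q * mat_diag n c * mat_diag n c" .
  have "mat_diag n b * Q = Q * mat_diag n c"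
  proof (rule eq_matI)
    fix i j assume "i < dim_row (Q * mat_diag n c)" "j < dim_col (Q * mat_diag n c)"
    then have ij: "i < n" "j < n" using Q by simp_all
    have "(mat_diag n b * (mat_diag n b * Q)) $$ (i,j) = (b i)\<^sup>2 * Q $$ (i,j)"
      using ij Q by (simp add: mat_diag_mult_left[of _ n n] power2_eq_square)
    moreover have "(Q * mat_diag n c * mat_diag n c) $$ (i,j) = (c j)\<^sup>2 * Q $$ (i,j)"
      using ij Q by (simp add: mat_diag_mult_right[of _ n n] power2_eq_square)
    ultimately have "(b i)\<^sup>2 * Q $$ (i,j) = (c j)\<^sup>2 * Q $$ (i,j)"
      unfolding intertwine2 by presburger
    then have "b i = c j \<or> Q $$ (i,j) = 0"
      using b c ij by (metis mult_right_cancel power2_eq_iff_nonneg)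
    then show "(mat_diag n b * Q) $$ (i,j) = (Q * mat_diag n c) $$ (i,j)"
      using ij Q by (auto simp: mat_diag_mult_right[of _ n n] mat_diag_mult_left[of _ n n])
  qed (use Q in auto)
  then have "Y * (mat_diag n b * Q) * transpose_mat Z = Y * (Q * mat_diag n c) * transpose_mat Z"
    by simp
  then show ?thesis
    unfolding BY CZ Q_def using Y Z by (simp add: mult_assoc_dim cancel)
qed

lemma sqrt_mat_eqI:
  assumes "B \<in> psd_mats n" "B * B = A" shows "sqrt_mat A = B"
proof -
  have "dim_row A = n" using assms psd_matsD[OF assms(1)] by auto
  then show ?thesis unfolding sqrt_mat_def
    using assms psd_sqrt_unique by (intro the_equality) auto
qed

lemma gram_diag_entry:
  fixes Z :: "real mat"
  assumes Z: "Z \<in> carrier_mat n m" and gram: "transpose_mat Z * Z = mat_diag m \<nu>"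
    and "k < m"
  shows "\<nu> k = (\<Sum>i<n. (Z $$ (i,k))\<^sup>2)"
proof -
  have "\<nu> k = (transpose_mat Z * Z) $$ (k,k)" unfolding gram using \<open>k < m\<close> by simp
  also have "\<dots> = (\<Sum>i<n. (Z $$ (i,k))\<^sup>2)"
    using Z \<open>k < m\<close> by (subst mult_mat_index) (auto simp: power2_eq_square)
  finally show ?thesis .
qed

text \<open>The columns of \<open>Z\<close> are orthogonal eigenvectors of \<open>Z Z\<^sup>T\<close> with eigenvalues \<open>\<nu>\<close>, but not normalised:
dividing by \<open>\<surd>\<nu>\<close> instead of multiplying by it compensates for their squared lengths \<open>\<nu>\<close>. Zero columns
contribute nothing, in agreement with the convention \<open>1 / 0 = 0\<close>.\<close>

lemma sqrt_mat_gram: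
  fixes Z :: "real mat"
  assumes Z: "Z \<in> carrier_mat n m" and gram: "transpose_mat Z * Z = mat_diag m \<nu>"
  shows "sqrt_mat (Z * transpose_mat Z) = Z * mat_diag m (\<lambda>k. 1 / sqrt (\<nu> k)) * transpose_mat Z"
proof (rule sqrt_mat_eqI)
  note norm2 = gram_diag_entry[OF Z gram]
  have \<nu>: "\<nu> k \<ge> 0" if "k < m" for k unfolding norm2[OF that] by (intro sum_nonneg) simp
  show "Z * mat_diag m (\<lambda>k. 1 / sqrt (\<nu> k)) * transpose_mat Z \<in> psd_mats n"
    using \<nu> by (intro scaled_gram_psd[OF Z]) auto
  have cancel: "transpose_mat Z * (Z * C) = mat_diag m \<nu> * C" if "dim_row C = m" for C
    unfolding gram[symmetric] using that Z by (intro mult_assoc_dim[symmetric]) auto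
  have "(Z * mat_diag m (\<lambda>k. 1 / sqrt (\<nu> k)) * transpose_mat Z)
      * (Z * mat_diag m (\<lambda>k. 1 / sqrt (\<nu> k)) * transpose_mat Z)
      = Z * mat_diag m (\<lambda>k. 1 / sqrt (\<nu> k)) * (mat_diag m \<nu> * mat_diag m (\<lambda>k. 1 / sqrt (\<nu> k)))
        * transpose_mat Z"
    using Z by (simp add: mult_assoc_dim cancel del: mat_diag_diag)
  also have "\<dots> = Z * mat_diag m (\<lambda>k. (1 / sqrt (\<nu> k)) * (\<nu> k * (1 / sqrt (\<nu> k)))) * transpose_mat Z"
    using Z by (subst mult_assoc_dim[of Z]) (simp_all only: mat_diag_diag mat_diag_index carrier_matD)
  also have "Z * mat_diag m (\<lambda>k. (1 / sqrt (\<nu> k)) * (\<nu> k * (1 / sqrt (\<nu> k)))) = Z"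
  proof (rule eq_matI)
    fix i k assume ik: "i < dim_row Z" "k < dim_col Z"
    have "Z $$ (i,k) = 0" if "\<nu> k = 0"
    proof -
      have "(\<Sum>i<n. (Z $$ (i,k))\<^sup>2) = 0" using norm2[of k] that ik Z by simp
      then show ?thesis using ik Z by (subst (asm) sum_nonneg_eq_0_iff) auto
    qed
    then show "(Z * mat_diag m (\<lambda>k. (1 / sqrt (\<nu> k)) * (\<nu> k * (1 / sqrt (\<nu> k))))) $$ (i,k) = Z $$ (i,k)"
      using ik Z \<nu>[of k] by (cases "\<nu> k = 0") (auto simp: mat_diag_mult_right[OF Z])
  qed (use Z in auto)
  finally show "(Z * mat_diag m (\<lambda>k. 1 / sqrt (\<nu> k)) * transpose_mat Z)
      * (Z * mat_diag m (\<lambda>k. 1 / sqrt (\<nu> k)) * transpose_mat Z) = Z * transpose_mat Z" .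
qed

lemma trace_sqrt_gram:
  fixes Z :: "real mat"
  assumes Z: "Z \<in> carrier_mat n m" and gram: "transpose_mat Z * Z = mat_diag m \<nu>"
  shows "trace_mat (sqrt_mat (Z * transpose_mat Z)) = (\<Sum>k<m. sqrt (\<nu> k))"
proof -
  have \<nu>: "\<nu> k \<ge> 0" if "k < m" for k
    unfolding gram_diag_entry[OF Z gram that] by (intro sum_nonneg) simp
  have "trace_mat (sqrt_mat (Z * transpose_mat Z))
      = trace_mat (transpose_mat Z * (Z * mat_diag m (\<lambda>k. 1 / sqrt (\<nu> k))))"
    unfolding sqrt_mat_gram[OF assms] using Z
    by (intro trace_mult_commute[of _ n m]) (auto intro!: carrier_matI)
  also have "transpose_mat Z * (Z * mat_diag m (\<lambda>k. 1 / sqrt (\<nu> k)))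
      = mat_diag m \<nu> * mat_diag m (\<lambda>k. 1 / sqrt (\<nu> k))"
    unfolding gram[symmetric] using Z by (simp add: mult_assoc_dim)
  also have "trace_mat \<dots> = (\<Sum>k<m. sqrt (\<nu> k))"
    using \<nu> by (auto simp: trace_mat_def real_div_sqrt)
  finally show ?thesis .
qed

lemma psd_spectral_sqrt:
  assumes "A \<in> psd_mats n"
  obtains Y \<nu> where "Y \<in> carrier_mat n n" "transpose_mat Y * Y = 1\<^sub>m n" "Y * transpose_mat Y = 1\<^sub>m n"
    "A = Y * mat_diag n \<nu> * transpose_mat Y"
    "\<And>i j. i \<le> j \<Longrightarrow> j < n \<Longrightarrow> \<nu> j \<le> \<nu> i" "\<And>i. i < n \<Longrightarrow> \<nu> i \<ge> 0"
    "trace_mat (sqrt_mat A) = (\<Sum>k<n. sqrt (\<nu> k))"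
    "sqrt_mat A \<in> psd_mats n" "sqrt_mat A * sqrt_mat A = A"
proof -
  obtain Y \<nu> where Y: "Y \<in> carrier_mat n n" "transpose_mat Y * Y = 1\<^sub>m n" "Y * transpose_mat Y = 1\<^sub>m n"
    and AY: "A = Y * mat_diag n \<nu> * transpose_mat Y"
    and \<nu>: "\<And>i j. i \<le> j \<Longrightarrow> j < n \<Longrightarrow> \<nu> j \<le> \<nu> i" "\<And>i. i < n \<Longrightarrow> \<nu> i \<ge> 0"
    using spectral_psd[OF assms] by metis
  define R where "R = Y * mat_diag n (\<lambda>k. sqrt (\<nu> k)) * transpose_mat Y"
  have sq: "mat_diag n (\<lambda>k. sqrt (\<nu> k)) * mat_diag n (\<lambda>k. sqrt (\<nu> k)) = mat_diag n \<nu>"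
    using \<nu>(2) by (intro eq_matI) auto
  have R: "R \<in> psd_mats n" unfolding R_def using \<nu> Y(1) by (intro scaled_gram_psd) auto
  have RR: "R * R = A" unfolding R_def mult_scaled_isometry[OF Y(1,2)] AY mat_diag_diag[symmetric] sq ..
  have sqA: "sqrt_mat A = R" using sqrt_mat_eqI[OF R RR] .
  have "trace_mat R = (\<Sum>k<n. sqrt (\<nu> k))" unfolding R_def by (rule trace_scaled_isometry[OF Y(1,2)])
  then show ?thesis using that[OF Y AY \<nu>] R RR unfolding sqA by blast
qed

text \<open>If \<open>X\<^sup>T X = Y \<nu> Y\<^sup>T\<close>, then the columns of \<open>X Y\<close> are orthogonal with squared norms \<open>\<nu>\<close>, while
\<open>(X Y) (X Y)\<^sup>T = X X\<^sup>T\<close>. Both traces are therefore \<open>\<Sum> \<surd>\<nu>\<close>.\<close>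

lemma trace_sqrt_swap:
  fixes X :: "real mat"
  assumes X: "X \<in> carrier_mat n m"
  shows "trace_mat (sqrt_mat (transpose_mat X * X)) = trace_mat (sqrt_mat (X * transpose_mat X))"
proof -
  have "transpose_mat X * X \<in> psd_mats m" using gram_psd[of "transpose_mat X" m n] X by simp
  then obtain Y \<nu> where Y: "Y \<in> carrier_mat m m" "transpose_mat Y * Y = 1\<^sub>m m"
      "Y * transpose_mat Y = 1\<^sub>m m"
    and XY: "transpose_mat X * X = Y * mat_diag m \<nu> * transpose_mat Y"
    and tr: "trace_mat (sqrt_mat (transpose_mat X * X)) = (\<Sum>k<m. sqrt (\<nu> k))"
    using psd_spectral_sqrt by metis
  have "X * Y * transpose_mat (X * Y) = X * transpose_mat X"
    using X Y by (simp add: transpose_mult_dim mult_assoc_dim mult_cancel_mid[OF Y(3)])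
  moreover have "transpose_mat (X * Y) * (X * Y) = mat_diag m \<nu>"
  proof -
    have "transpose_mat (X * Y) * (X * Y) = transpose_mat Y * (transpose_mat X * X) * Y"
      using X Y by (simp add: transpose_mult_dim mult_assoc_dim)
    also have "\<dots> = mat_diag m \<nu>"
      unfolding XY using Y by (simp add: mult_assoc_dim mult_cancel_mid[OF Y(2)])
    finally show ?thesis .
  qed
  ultimately show ?thesis
    using trace_sqrt_gram[of "X * Y" n m \<nu>] X Y tr by (simp add: mult_carrier_mat[of _ n m])
qed

lemma sqrt_mat_psd:
  assumes "A \<in> psd_mats n"
  shows "sqrt_mat A \<in> psd_mats n" "sqrt_mat A * sqrt_mat A = A"
  using psd_spectral_sqrt[OF assms] by metis+

section \<open>Majorization of sequences\<close>

text \<open>Weights in \<open>[0, 1]\<close> of total mass at most \<open>k\<close> are best spent on the \<open>k\<close> largest terms. The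
proof subtracts the threshold \<open>b k\<close> from all terms.\<close>

lemma weighted_sum_le_prefix:
  fixes b m :: "nat \<Rightarrow> real"
  assumes anti: "\<And>i j. i \<le> j \<Longrightarrow> b j \<le> b i" and nonneg: "\<And>i. b i \<ge> 0"
    and m: "\<And>i. i < n \<Longrightarrow> 0 \<le> m i \<and> m i \<le> 1" and mass: "(\<Sum>i<n. m i) \<le> real k"
  shows "(\<Sum>i<n. b i * m i) \<le> (\<Sum>i<k. b i)"
proof (cases "k \<le> n")
  case True
  have "(\<Sum>i<n. b i * m i) = (\<Sum>i<n. (b i - b k) * m i) + b k * (\<Sum>i<n. m i)"
    by (simp add: algebra_simps sum_distrib_left sum_subtractf)
  also have "\<dots> \<le> (\<Sum>i<n. if i < k then b i - b k else 0) + b k * real k"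
  proof (intro add_mono sum_mono mult_left_mono)
    fix i assume "i \<in> {..<n}"
    then have "0 \<le> m i" "m i \<le> 1" using m by auto
    then show "(b i - b k) * m i \<le> (if i < k then b i - b k else 0)"
      using anti[of i k] anti[of k i] by (auto simp: mult_left_le mult_nonpos_nonneg)
  qed (use mass nonneg in auto)
  also have "(\<Sum>i<n. if i < k then b i - b k else 0) = (\<Sum>i<k. b i - b k)"
  proof -
    have "{..<n} \<inter> {i. i < k} = {..<k}" using True by auto
    then show ?thesis by (simp add: sum.If_cases)
  qed
  finally show ?thesis by (simp add: sum_subtractf)
next
  case False
  have "(\<Sum>i<n. b i * m i) \<le> (\<Sum>i<n. b i)"
    using m nonneg by (intro sum_mono) (auto simp: mult_left_le)
  also have "\<dots> \<le> (\<Sum>i<k. b i)"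
    using False nonneg by (intro sum_mono2) auto
  finally show ?thesis .
qed

text \<open>Summation by parts; it turns an inequality between partial sums into one for arbitrary
non-negative decreasing weights.\<close>

lemma abel_nonneg:
  fixes a y :: "nat \<Rightarrow> real"
  assumes anti: "\<And>i j. i \<le> j \<Longrightarrow> j < n \<Longrightarrow> a j \<le> a i" and nonneg: "\<And>i. i < n \<Longrightarrow> a i \<ge> 0"
    and prefix: "\<And>k. k \<le> n \<Longrightarrow> 0 \<le> (\<Sum>i<k. y i)"
  shows "0 \<le> (\<Sum>i<n. a i * y i)"
proof -
  have "a k * (\<Sum>i<Suc k. y i) \<le> (\<Sum>i<Suc k. a i * y i)" if "k < n" for k
    using that
  proof (induction k)
    case (Suc k)
    have "a (Suc k) * (\<Sum>i<Suc k. y i) \<le> a k * (\<Sum>i<Suc k. y i)"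
      using anti[of k "Suc k"] prefix[of "Suc k"] Suc.prems by (intro mult_right_mono) auto
    with Suc show ?case by (simp add: algebra_simps)
  qed simp
  from this[of "n - 1"] nonneg[of "n - 1"] prefix[of n] show ?thesis
    by (cases n) (auto intro: order_trans[OF mult_nonneg_nonneg])
qed

text \<open>Schur-convexity of the sum of squares: \<open>\<sigma>\<^sup>2 - \<nu>\<^sup>2 \<ge> 2 \<nu> (\<sigma> - \<nu>)\<close>, and the weights \<open>\<nu>\<close> decrease.\<close>

lemma majorized_sum_squares:
  fixes \<nu> \<sigma> :: "nat \<Rightarrow> real"
  assumes anti: "\<And>i j. i \<le> j \<Longrightarrow> j < n \<Longrightarrow> \<nu> j \<le> \<nu> i" and nonneg: "\<And>i. i < n \<Longrightarrow> \<nu> i \<ge> 0"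
    and maj: "\<And>k. k \<le> n \<Longrightarrow> (\<Sum>i<k. \<nu> i) \<le> (\<Sum>i<k. \<sigma> i)"
  shows "(\<Sum>i<n. (\<nu> i)\<^sup>2) \<le> (\<Sum>i<n. (\<sigma> i)\<^sup>2)"
proof -
  have "0 \<le> (\<Sum>i<n. \<nu> i * (\<sigma> i - \<nu> i))"
    using anti nonneg maj by (intro abel_nonneg) (auto simp: sum_subtractf)
  moreover have "0 \<le> (\<Sum>i<n. (\<sigma> i - \<nu> i)\<^sup>2)" by (intro sum_nonneg) simp
  moreover have "(\<Sum>i<n. (\<sigma> i)\<^sup>2) - (\<Sum>i<n. (\<nu> i)\<^sup>2)
      = (\<Sum>i<n. 2 * (\<nu> i * (\<sigma> i - \<nu> i)) + (\<sigma> i - \<nu> i)\<^sup>2)"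
    unfolding sum_subtractf[symmetric] by (rule sum.cong) (auto simp: power2_eq_square algebra_simps)
  ultimately show ?thesis by (simp add: sum.distrib sum_distrib_left[symmetric])
qed

text \<open>Schur-concavity of the sum of square roots. Here \<open>\<surd>\<nu> - \<surd>\<sigma> = (\<nu> - \<sigma>) / (\<surd>\<nu> + \<surd>\<sigma>)\<close> has
increasing weights. Subtracting them from a constant makes them decreasing, and the constant
cancels because the totals agree.\<close>

lemma majorized_sum_sqrt:
  fixes \<nu> \<sigma> :: "nat \<Rightarrow> real"
  assumes anti: "\<And>i j. i \<le> j \<Longrightarrow> j < n \<Longrightarrow> \<nu> j \<le> \<nu> i" and nonneg: "\<And>i. i < n \<Longrightarrow> \<nu> i \<ge> 0"
    and anti': "\<And>i j. i \<le> j \<Longrightarrow> j < n \<Longrightarrow> \<sigma> j \<le> \<sigma> i" and nonneg': "\<And>i. i < n \<Longrightarrow> \<sigma> i \<ge> 0"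
    and maj: "\<And>k. k \<le> n \<Longrightarrow> (\<Sum>i<k. \<nu> i) \<le> (\<Sum>i<k. \<sigma> i)"
    and total: "(\<Sum>i<n. \<nu> i) = (\<Sum>i<n. \<sigma> i)"
  shows "(\<Sum>i<n. sqrt (\<sigma> i)) \<le> (\<Sum>i<n. sqrt (\<nu> i))"
proof -
  \<comment> \<open>Indices with \<open>s i = 0\<close> form a final segment, so giving them the weight 0 keeps
    \<open>a\<close> decreasing. The constant \<open>C\<close> only has to bound every \<open>1 / s i\<close>.\<close>
  define s where "s i = sqrt (\<nu> i) + sqrt (\<sigma> i)" for i
  define C where "C = (\<Sum>i<n. 1 / s i)"
  define a where "a i = (if s i = 0 then 0 else C - 1 / s i)" for i
  have s0: "s i \<ge> 0" if "i < n" for i using that nonneg nonneg' by (simp add: s_def)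
  have s_anti: "s j \<le> s i" if "i \<le> j" "j < n" for i j
    using that anti anti' by (auto simp: s_def intro!: add_mono)
  have a0: "a i \<ge> 0" if "i < n" for i
  proof -
    have "1 / s i \<le> C" unfolding C_def using that s0 by (intro member_le_sum) auto
    then show ?thesis by (simp add: a_def)
  qed
  have a_anti: "a j \<le> a i" if "i \<le> j" "j < n" for i j
  proof (cases "s j = 0")
    case False
    then have "0 < s j" "s j \<le> s i" using s0[of j] s_anti that by auto
    then show ?thesis by (auto simp: a_def intro!: divide_left_mono)
  qed (use a0[of i] that in \<open>simp add: a_def\<close>)
  have "0 \<le> (\<Sum>i<n. a i * (\<sigma> i - \<nu> i))"
    using a0 a_anti maj by (intro abel_nonneg) (auto simp: sum_subtractf)
  also have "\<dots> = (\<Sum>i<n. C * (\<sigma> i - \<nu> i) + (sqrt (\<nu> i) - sqrt (\<sigma> i)))"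
  proof (rule sum.cong)
    fix i assume "i \<in> {..<n}"
    then have i: "\<nu> i \<ge> 0" "\<sigma> i \<ge> 0" using nonneg nonneg' by auto
    then have f: "\<nu> i - \<sigma> i = (sqrt (\<nu> i) - sqrt (\<sigma> i)) * s i"
      by (simp add: s_def algebra_simps)
    show "a i * (\<sigma> i - \<nu> i) = C * (\<sigma> i - \<nu> i) + (sqrt (\<nu> i) - sqrt (\<sigma> i))"
    proof (cases "s i = 0")
      case True
      then have "\<nu> i = 0 \<and> \<sigma> i = 0" using i by (simp add: s_def add_nonneg_eq_0_iff)
      then show ?thesis by simp
    next
      case False
      then have "a i * (\<sigma> i - \<nu> i) = C * (\<sigma> i - \<nu> i) + (\<nu> i - \<sigma> i) / s i"
        by (simp add: a_def field_simps)
      also have "(\<nu> i - \<sigma> i) / s i = sqrt (\<nu> i) - sqrt (\<sigma> i)" using False f by simp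
      finally show ?thesis .
    qed
  qed simp
  also have "\<dots> = (\<Sum>i<n. sqrt (\<nu> i)) - (\<Sum>i<n. sqrt (\<sigma> i))"
    using total by (simp add: sum.distrib sum_subtractf sum_distrib_left[symmetric])
  finally show ?thesis by simp
qed

text \<open>A Ky Fan inequality in coordinates: the matrix \<open>\<Sum>\<^sub>k \<nu>\<^sub>k B\<^sub>k B\<^sub>k\<^sup>T\<close> formed from the columns
\<open>B\<^sub>k\<close> of \<open>B\<close> is diagonal with entries \<open>b\<close>, and the trace of its first \<open>m\<close> summands is at most the sum of
the \<open>m\<close> largest of these entries. The proof uses the doubly substochastic weights \<open>\<nu>\<^sub>k B\<^sub>i\<^sub>k\<^sup>2 / b\<^sub>i\<close>.\<close>

lemma frame_prefix_bound:
  fixes \<nu> b :: "nat \<Rightarrow> real" and B :: "nat \<Rightarrow> nat \<Rightarrow> real"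
  assumes gram: "\<And>i j. i < p \<Longrightarrow> j < p \<Longrightarrow>
      (\<Sum>k<n. \<nu> k * (B i k * B j k)) = (if i = j then b i else 0)"
    and \<nu>: "\<And>k. k < n \<Longrightarrow> \<nu> k \<ge> 0"
    and anti: "\<And>i j. i \<le> j \<Longrightarrow> b j \<le> b i" and nonneg: "\<And>i. b i \<ge> 0"
    and m: "m \<le> n"
  shows "(\<Sum>k<m. \<nu> k * (\<Sum>i<p. (B i k)\<^sup>2)) \<le> (\<Sum>i<m. b i)"
proof -
  define P where "P i k = \<nu> k * (B i k)\<^sup>2 / b i" for i k
  have P0: "P i k \<ge> 0" if "k < n" for i k using that \<nu> nonneg by (simp add: P_def)
  have row: "(\<Sum>k<n. \<nu> k * (B i k)\<^sup>2) = b i" if "i < p" for i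
    using gram[of i i] that by (simp add: power2_eq_square)
  have bP: "b i * P i k = \<nu> k * (B i k)\<^sup>2" if "i < p" "k < n" for i k
  proof (cases "b i = 0")
    case True
    then have "(\<Sum>k<n. \<nu> k * (B i k)\<^sup>2) = 0" using row that by simp
    then have "\<nu> k * (B i k)\<^sup>2 = 0"
      using that \<nu> by (subst (asm) sum_nonneg_eq_0_iff) auto
    then show ?thesis by (simp add: P_def)
  qed (simp add: P_def)
  have rowP: "(\<Sum>k<m. P i k) \<le> 1" if "i < p" for i
  proof -
    have "(\<Sum>k<m. P i k) \<le> (\<Sum>k<n. P i k)" using m P0 by (intro sum_mono2) auto
    also have "\<dots> = b i / b i" unfolding P_def sum_divide_distrib[symmetric] row[OF that] ..
    finally show ?thesis by (auto split: if_splits simp: divide_self_if)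
  qed
  have colP: "(\<Sum>i<p. P i k) \<le> 1" if k: "k < n" for k
  proof -
    \<comment> \<open>Testing the quadratic form of the whole sum on the vector \<open>t\<close> gives \<open>T\<close>,
      while its \<open>k\<close>-th summand alone contributes \<open>\<nu>\<^sub>k T\<^sup>2\<close>.\<close>
    define T where "T = (\<Sum>i<p. (B i k)\<^sup>2 / b i)"
    define t where "t i = B i k / b i" for i
    have T0: "T \<ge> 0" unfolding T_def using nonneg by (intro sum_nonneg) auto
    have tT: "(\<Sum>i<p. t i * B i k) = T"
      unfolding T_def t_def by (rule sum.cong) (auto simp: power2_eq_square)
    have "\<nu> k * T\<^sup>2 \<le> (\<Sum>l<n. \<nu> l * (\<Sum>i<p. t i * B i l)\<^sup>2)"
      unfolding tT[symmetric] using k \<nu>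
      by (intro member_le_sum[where f = "\<lambda>l. \<nu> l * (\<Sum>i<p. t i * B i l)\<^sup>2"]) auto
    also have "\<dots> = (\<Sum>l<n. \<Sum>i<p. \<Sum>j<p. t i * t j * (\<nu> l * (B i l * B j l)))"
      by (rule sum.cong) (auto simp: power2_eq_square sum_product sum_distrib_left algebra_simps)
    also have "\<dots> = (\<Sum>i<p. \<Sum>j<p. t i * t j * (\<Sum>l<n. \<nu> l * (B i l * B j l)))"
      unfolding sum_distrib_left
      by (subst sum.swap, rule sum.cong[OF refl], subst sum.swap, rule refl)
    also have "\<dots> = (\<Sum>i<p. \<Sum>j<p. if j = i then t i * t i * b i else 0)"
      by (intro sum.cong) (auto simp: gram)
    also have "\<dots> = (\<Sum>i<p. t i * t i * b i)" by simp
    also have "\<dots> = T" unfolding T_def t_def by (rule sum.cong) (auto simp: power2_eq_square)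
    finally have le: "(\<nu> k * T) * T \<le> 1 * T" by (simp add: power2_eq_square)
    have "\<nu> k * T \<le> 1"
    proof (cases "T = 0")
      case False
      then show ?thesis using T0 le by (intro mult_right_le_imp_le[OF le]) auto
    qed simp
    then show ?thesis by (simp add: P_def T_def sum_distrib_left)
  qed
  have "(\<Sum>k<m. \<nu> k * (\<Sum>i<p. (B i k)\<^sup>2)) = (\<Sum>k<m. \<Sum>i<p. b i * P i k)"
    using m by (auto simp: sum_distrib_left bP intro!: sum.cong)
  also have "\<dots> = (\<Sum>i<p. b i * (\<Sum>k<m. P i k))"
    by (subst sum.swap) (simp add: sum_distrib_left)
  also have "\<dots> \<le> (\<Sum>i<m. b i)"
  proof (rule weighted_sum_le_prefix[OF anti nonneg])
    show "0 \<le> (\<Sum>k<m. P i k) \<and> (\<Sum>k<m. P i k) \<le> 1" if "i < p" for i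
      using rowP[OF that] P0 m by (auto intro!: sum_nonneg)
    have "(\<Sum>i<p. \<Sum>k<m. P i k) = (\<Sum>k<m. \<Sum>i<p. P i k)" by (rule sum.swap)
    also have "\<dots> \<le> (\<Sum>k<m. 1)" using colP m by (intro sum_mono) auto
    finally show "(\<Sum>i<p. \<Sum>k<m. P i k) \<le> real m" by simp
  qed
  finally show ?thesis .
qed

section \<open>Eigenvalues of couplings\<close>

text \<open>Continuing by zeros gives the spectra of both blocks a common index range.\<close>

definition diag_entries :: "nat \<Rightarrow> real mat \<Rightarrow> nat \<Rightarrow> real" where
  "diag_entries n L i = (if i < n then L $$ (i,i) else 0)"

lemma sum_diag_entries:
  assumes "n \<le> m" shows "(\<Sum>i<m. diag_entries n L i) = (\<Sum>i<n. L $$ (i,i))"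
proof -
  have "{..<m} \<inter> {i. i < n} = {..<n}" using assms by auto
  then show ?thesis by (simp add: diag_entries_def sum.If_cases)
qed

lemma ordered_eigendecompD:
  assumes A: "A \<in> psd_mats n" and dec: "ordered_eigendecomp n A U L"
  defines "b \<equiv> diag_entries n L"
  shows "U \<in> carrier_mat n n" "transpose_mat U * U = 1\<^sub>m n" "U * transpose_mat U = 1\<^sub>m n"
    "L = mat_diag n b" "A = U * mat_diag n b * transpose_mat U"
    "\<And>i. b i \<ge> 0" "\<And>i j. i \<le> j \<Longrightarrow> b j \<le> b i"
proof -
  show U: "U \<in> carrier_mat n n" "transpose_mat U * U = 1\<^sub>m n" "U * transpose_mat U = 1\<^sub>m n"
    using dec by (auto simp: ordered_eigendecomp_def)
  have L: "L \<in> carrier_mat n n" "diagonal_mat L" "sorted_wrt (\<ge>) (diag_mat L)"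
    using dec by (auto simp: ordered_eigendecomp_def)
  show Lb: "L = mat_diag n b"
    using L by (intro eq_matI) (auto simp: b_def diag_entries_def diagonal_mat_def)
  show Ab: "A = U * mat_diag n b * transpose_mat U"
    using dec unfolding Lb[symmetric] by (simp add: ordered_eigendecomp_def)
  show nonneg: "b i \<ge> 0" for i
    using psd_eigenvalue_nonneg[OF A U(1,2) Ab, of i]
    by (cases "i < n") (auto simp: b_def diag_entries_def)
  show "b j \<le> b i" if "i \<le> j" for i j
  proof (cases "i < j \<and> j < n")
    case True
    then have "diag_mat L ! i \<ge> diag_mat L ! j"
      using L(1) by (intro sorted_wrt_nth_less[OF L(3)]) (auto simp: diag_mat_def)
    then show ?thesis using True L by (auto simp: b_def diag_entries_def diag_mat_def)
  next
    case False
    then show ?thesis using that nonneg[of i] by (cases "i = j") (auto simp: b_def diag_entries_def)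
  qed
qed

lemma couplingD:
  assumes "S \<in> block_couplings p q S1 S2"
  shows "S \<in> psd_mats (p + q)" "S1 \<in> carrier_mat p p" "S2 \<in> carrier_mat q q"
    "upper_right p p S \<in> carrier_mat p q"
    "S = four_block_mat S1 (upper_right p p S) (transpose_mat (upper_right p p S)) S2"
proof -
  show S: "S \<in> psd_mats (p + q)" using assms by (simp add: block_couplings_def)
  note S' = psd_matsD[OF S]
  have ul: "S1 = mat p p (\<lambda>ij. S $$ ij)" and lr: "S2 = mat q q (\<lambda>(i,j). S $$ (i + p, j + p))"
    and ur: "upper_right p p S = mat p q (\<lambda>(i,j). S $$ (i, j + p))"
    using assms S'
    by (auto simp: block_couplings_def upper_left_def lower_right_def upper_right_def
        split_block_def Let_def)
  show "S1 \<in> carrier_mat p p" "S2 \<in> carrier_mat q q" "upper_right p p S \<in> carrier_mat p q"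
    by (simp_all add: ul lr ur)
  have sym: "S $$ (i,j) = S $$ (j,i)" if "i < p + q" "j < p + q" for i j
  proof -
    have "transpose_mat S $$ (j,i) = S $$ (i,j)" using that S'(3,4) by simp
    then show ?thesis unfolding S'(2) by simp
  qed
  show "S = four_block_mat S1 (upper_right p p S) (transpose_mat (upper_right p p S)) S2"
    using S'(3,4) sym by (intro eq_matI) (auto simp: ul lr ur)
qed

lemma upper_right_four_block:
  assumes "A \<in> carrier_mat p p" "B \<in> carrier_mat p q" "D \<in> carrier_mat q q"
  shows "upper_right p p (four_block_mat A B C D) = B"
  using assms by (auto simp: upper_right_def split_block_def Let_def intro!: eq_matI)

lemma four_block_couplingI:
  assumes "four_block_mat A B C D \<in> psd_mats (p + q)"
    and "A \<in> carrier_mat p p" "D \<in> carrier_mat q q"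
  shows "four_block_mat A B C D \<in> block_couplings p q A D"
  using assms
  by (auto simp: block_couplings_def upper_left_def lower_right_def split_block_def Let_def
      intro!: eq_matI)

lemma trace_four_block:
  assumes "A \<in> carrier_mat p p" "D \<in> carrier_mat q q"
  shows "trace_mat (four_block_mat A B C D) = trace_mat A + trace_mat D"
  using assms by (auto simp: trace_mat_def sum_lessThan_add)

text \<open>Since the blocks are fixed, maximizing \<open>tr \<Psi>\<Psi>\<^sup>T\<close> is the same as maximizing \<open>tr S\<^sup>2\<close>, which is a
function of the spectrum of \<open>S\<close>.\<close>

lemma trace_coupling_square:
  assumes S: "S \<in> block_couplings p q S1 S2"
  shows "trace_mat (S * S) = trace_mat (S1 * S1) + trace_mat (S2 * S2) + 2 * sq_cross_cov p S"
proof -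
  define \<Psi> where "\<Psi> = upper_right p p S"
  note S' = couplingD[OF S, folded \<Psi>_def]
  have "S * S = four_block_mat S1 \<Psi> (transpose_mat \<Psi>) S2 * four_block_mat S1 \<Psi> (transpose_mat \<Psi>) S2"
    by (rule arg_cong2[where f = "(*)", OF S'(5) S'(5)])
  also have "\<dots> = four_block_mat (S1 * S1 + \<Psi> * transpose_mat \<Psi>) (S1 * \<Psi> + \<Psi> * S2)
      (transpose_mat \<Psi> * S1 + S2 * transpose_mat \<Psi>) (transpose_mat \<Psi> * \<Psi> + S2 * S2)"
    using S'(2-4) by (intro mult_four_block_mat[of _ p p _ q _ q _ _ p _ q]) auto
  also have "trace_mat \<dots> = trace_mat (S1 * S1) + trace_mat (\<Psi> * transpose_mat \<Psi>)
      + (trace_mat (transpose_mat \<Psi> * \<Psi>) + trace_mat (S2 * S2))"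
    using S'(2-4) by (subst trace_four_block[of _ p _ q])
      (auto intro!: carrier_matI simp: trace_mat_def sum.distrib)
  also have "trace_mat (transpose_mat \<Psi> * \<Psi>) = trace_mat (\<Psi> * transpose_mat \<Psi>)"
    using S'(4) by (intro trace_mult_commute[of _ q p]) auto
  finally show ?thesis by (simp add: sq_cross_cov_def \<Psi>_def)
qed

text \<open>The columns of \<open>C = U\<^sup>T Y\<close> are the eigenvectors of \<open>S\<close> in the coordinates that diagonalize both
blocks. The two blocks of rows of \<open>C\<close> each satisfy the hypotheses of the frame inequality, and their
squared column norms add up to 1.\<close>

lemma coupling_eigenvalues_majorized:
  assumes S: "S \<in> block_couplings p q S1 S2"
    and S1: "S1 \<in> psd_mats p" and S2: "S2 \<in> psd_mats q"
    and dec1: "ordered_eigendecomp p S1 U1 L1" and dec2: "ordered_eigendecomp q S2 U2 L2"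
    and Y: "Y \<in> carrier_mat (p + q) (p + q)" "transpose_mat Y * Y = 1\<^sub>m (p + q)"
      "Y * transpose_mat Y = 1\<^sub>m (p + q)"
    and SY: "S = Y * mat_diag (p + q) \<nu> * transpose_mat Y"
    and m: "m \<le> p + q"
  shows "(\<Sum>k<m. \<nu> k) \<le> (\<Sum>k<m. diag_entries p L1 k + diag_entries q L2 k)"
proof -
  note d1 = ordered_eigendecompD[OF S1 dec1] and d2 = ordered_eigendecompD[OF S2 dec2]
  define \<Psi> where "\<Psi> = upper_right p p S"
  note S' = couplingD[OF S, folded \<Psi>_def]
  define \<alpha> where "\<alpha> = diag_entries p L1"
  define \<beta> where "\<beta> = diag_entries q L2"
  define U where "U = four_block_mat U1 (0\<^sub>m p q) (0\<^sub>m q p) U2"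
  define C where "C = transpose_mat U * Y"
  have UT: "transpose_mat U = four_block_mat (transpose_mat U1) (0\<^sub>m p q) (0\<^sub>m q p) (transpose_mat U2)"
    unfolding U_def using d1(1) d2(1) by (subst transpose_four_block_mat[of _ p p _ q _ q]) auto
  have U: "U \<in> carrier_mat (p + q) (p + q)" using d1(1) d2(1) by (simp add: U_def)
  have C: "C \<in> carrier_mat (p + q) (p + q)" using U Y by (auto simp: C_def intro!: carrier_matI)
  have UU: "U * transpose_mat U = 1\<^sub>m (p + q)"
    unfolding UT unfolding U_def using d1(1,3) d2(1,3)
    by (subst mult_four_block_mat[of _ p p _ q _ q _ _ p _ q]) auto
  have CC: "transpose_mat C * C = 1\<^sub>m (p + q)"
    unfolding C_def using U Y
    by (simp add: transpose_mult_dim mult_assoc_dim mult_cancel_mid[OF UU])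
  have conj: "C * mat_diag (p + q) \<nu> * transpose_mat C = transpose_mat U * S * U"
    unfolding C_def SY using U Y by (simp add: transpose_mult_dim mult_assoc_dim)
  have "transpose_mat U1 * S1 * U1 = mat_diag p \<alpha>" "transpose_mat U2 * S2 * U2 = mat_diag q \<beta>"
    using d1(1,2) d2(1,2) unfolding d1(5) d2(5) \<alpha>_def \<beta>_def
    by (simp_all add: mult_assoc_dim mult_cancel_mid[OF d1(2)] mult_cancel_mid[OF d2(2)])
  then have block: "transpose_mat U * S * U = four_block_mat (mat_diag p \<alpha>)
      (transpose_mat U1 * \<Psi> * U2)
      (transpose_mat U2 * transpose_mat (\<Psi>) * U1) (mat_diag q \<beta>)"
    unfolding UT unfolding U_def using S'(2-4) d1(1) d2(1)
    by (subst S'(5), subst block_diag_mult_block_diag) auto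
  have entry: "(\<Sum>k<p + q. \<nu> k * (C $$ (i,k) * C $$ (j,k))) = (transpose_mat U * S * U) $$ (i,j)"
    if "i < p + q" "j < p + q" for i j
    unfolding conj[symmetric] using scaled_gram_index[OF C that] by simp
  have \<nu>: "\<nu> k \<ge> 0" if "k < p + q" for k
    using psd_eigenvalue_nonneg[OF S'(1) Y(1,2) SY that] .
  have "(\<Sum>k<m. \<nu> k * (\<Sum>i<p. (C $$ (i,k))\<^sup>2)) \<le> (\<Sum>i<m. \<alpha> i)"
  proof (rule frame_prefix_bound[where n = "p + q"])
    show "(\<Sum>k<p + q. \<nu> k * (C $$ (i,k) * C $$ (j,k))) = (if i = j then \<alpha> i else 0)"
      if "i < p" "j < p" for i j
      using that by (simp add: entry block)
  qed (use \<nu> m d1 in \<open>auto simp: \<alpha>_def\<close>)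
  moreover have "(\<Sum>k<m. \<nu> k * (\<Sum>i<q. (C $$ (p + i,k))\<^sup>2)) \<le> (\<Sum>i<m. \<beta> i)"
  proof (rule frame_prefix_bound[where n = "p + q"])
    show "(\<Sum>k<p + q. \<nu> k * (C $$ (p + i,k) * C $$ (p + j,k))) = (if i = j then \<beta> i else 0)"
      if "i < q" "j < q" for i j
      using that by (simp add: entry block)
  qed (use \<nu> m d2 in \<open>auto simp: \<beta>_def\<close>)
  moreover have "(\<Sum>i<p. (C $$ (i,k))\<^sup>2) + (\<Sum>i<q. (C $$ (p + i,k))\<^sup>2) = 1" if "k < p + q" for k
    using gram_diag_entry[OF C, of "\<lambda>_. 1" k] CC that by (simp add: sum_lessThan_add)
  then have "(\<Sum>k<m. \<nu> k) = (\<Sum>k<m. \<nu> k * (\<Sum>i<p. (C $$ (i,k))\<^sup>2)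
      + \<nu> k * (\<Sum>i<q. (C $$ (p + i,k))\<^sup>2))"
    using m by (intro sum.cong) (auto simp: distrib_left[symmetric])
  ultimately show ?thesis by (simp add: sum.distrib \<alpha>_def \<beta>_def)
qed

lemma coupling_bounds:
  assumes S: "S \<in> block_couplings p q S1 S2"
    and S1: "S1 \<in> psd_mats p" and S2: "S2 \<in> psd_mats q"
    and dec1: "ordered_eigendecomp p S1 U1 L1" and dec2: "ordered_eigendecomp q S2 U2 L2"
  defines "\<sigma> \<equiv> \<lambda>k. diag_entries p L1 k + diag_entries q L2 k"
  shows "(\<Sum>k<p + q. sqrt (\<sigma> k)) \<le> trace_mat (sqrt_mat S)"
    and "trace_mat (S * S) \<le> (\<Sum>k<p + q. (\<sigma> k)\<^sup>2)"
proof -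
  note d1 = ordered_eigendecompD[OF S1 dec1] and d2 = ordered_eigendecompD[OF S2 dec2]
  note S' = couplingD[OF S]
  obtain Y \<nu> where Y: "Y \<in> carrier_mat (p + q) (p + q)" "transpose_mat Y * Y = 1\<^sub>m (p + q)"
      "Y * transpose_mat Y = 1\<^sub>m (p + q)"
    and SY: "S = Y * mat_diag (p + q) \<nu> * transpose_mat Y"
    and anti: "\<And>i j. i \<le> j \<Longrightarrow> j < p + q \<Longrightarrow> \<nu> j \<le> \<nu> i" and nonneg: "\<And>i. i < p + q \<Longrightarrow> \<nu> i \<ge> 0"
    and tr: "trace_mat (sqrt_mat S) = (\<Sum>k<p + q. sqrt (\<nu> k))"
    using psd_spectral_sqrt[OF S'(1)] by blast
  have maj: "(\<Sum>i<k. \<nu> i) \<le> (\<Sum>i<k. \<sigma> i)" if "k \<le> p + q" for k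
    unfolding \<sigma>_def by (rule coupling_eigenvalues_majorized[OF S S1 S2 dec1 dec2 Y SY that])
  have "trace_mat S1 = (\<Sum>i<p. L1 $$ (i,i))" "trace_mat S2 = (\<Sum>i<q. L2 $$ (i,i))"
    unfolding d1(5) d2(5) trace_scaled_isometry[OF d1(1,2)] trace_scaled_isometry[OF d2(1,2)]
    by (simp_all add: diag_entries_def)
  moreover have "trace_mat S = trace_mat S1 + trace_mat S2"
    by (subst S'(5)) (rule trace_four_block[OF S'(2,3)])
  ultimately have total: "(\<Sum>i<p + q. \<nu> i) = (\<Sum>i<p + q. \<sigma> i)"
    using trace_scaled_isometry[OF Y(1,2), of \<nu>] unfolding SY[symmetric] \<sigma>_def
    by (simp add: sum.distrib sum_diag_entries)
  show "(\<Sum>k<p + q. sqrt (\<sigma> k)) \<le> trace_mat (sqrt_mat S)"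
    unfolding tr using anti nonneg maj total d1(6,7) d2(6,7)
    by (intro majorized_sum_sqrt) (auto simp: \<sigma>_def intro: add_mono)
  have "trace_mat (S * S) = (\<Sum>k<p + q. (\<nu> k)\<^sup>2)"
    unfolding SY mult_scaled_isometry[OF Y(1,2)] trace_scaled_isometry[OF Y(1,2)]
    by (simp add: power2_eq_square)
  also have "\<dots> \<le> (\<Sum>k<p + q. (\<sigma> k)\<^sup>2)"
    using anti nonneg maj by (rule majorized_sum_squares)
  finally show "trace_mat (S * S) \<le> (\<Sum>k<p + q. (\<sigma> k)\<^sup>2)" .
qed

section \<open>The extremal coupling\<close>

lemma sqrt_mat_diag:
  assumes "\<And>k. k < n \<Longrightarrow> f k \<ge> 0"
  shows "sqrt_mat (mat_diag n f) = mat_diag n (\<lambda>k. sqrt (f k))"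
proof (rule sqrt_mat_eqI)
  have "1\<^sub>m n * mat_diag n (\<lambda>k. sqrt (f k)) * transpose_mat (1\<^sub>m n) \<in> psd_mats n"
    using assms by (intro scaled_gram_psd) auto
  then show "mat_diag n (\<lambda>k. sqrt (f k)) \<in> psd_mats n" by simp
  show "mat_diag n (\<lambda>k. sqrt (f k)) * mat_diag n (\<lambda>k. sqrt (f k)) = mat_diag n f"
    using assms by (intro eq_matI) auto
qed

lemma psi_max_eq:
  assumes S1: "S1 \<in> psd_mats p" and S2: "S2 \<in> psd_mats q"
    and dec1: "ordered_eigendecomp p S1 U1 L1" and dec2: "ordered_eigendecomp q S2 U2 L2"
  shows "psi_max p q U1 L1 U2 L2 = U1 * mat p q (\<lambda>(i,j). if i = j
    then sqrt (diag_entries p L1 i) * sqrt (diag_entries q L2 i) else 0) * transpose_mat U2"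
proof -
  note d1 = ordered_eigendecompD[OF S1 dec1] and d2 = ordered_eigendecompD[OF S2 dec2]
  define P :: "real mat" where "P = upper_left p q (1\<^sub>m (p + q))"
  have P: "P = mat p q (\<lambda>(i,j). if i = j then 1 else 0)"
    by (auto simp: P_def upper_left_def split_block_def Let_def intro!: eq_matI)
  have "psi_max p q U1 L1 U2 L2 = U1 * (mat_diag p (\<lambda>k. sqrt (diag_entries p L1 k)) * P
      * mat_diag q (\<lambda>k. sqrt (diag_entries q L2 k))) * transpose_mat U2"
    unfolding psi_max_def P_def[symmetric] using d1(1) d2(1)
    by (subst (1) d1(4), subst (1) d2(4))
      (simp add: sqrt_mat_diag d1(6) d2(6) mult_assoc_dim P)
  also have "mat_diag p (\<lambda>k. sqrt (diag_entries p L1 k)) * P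
      * mat_diag q (\<lambda>k. sqrt (diag_entries q L2 k)) = mat p q (\<lambda>(i,j). if i = j
    then sqrt (diag_entries p L1 i) * sqrt (diag_entries q L2 i) else 0)"
    unfolding P
    by (subst mat_diag_mult_left[of _ p q], simp, subst mat_diag_mult_right[of _ p q], simp)
      (auto intro!: eq_matI)
  finally show ?thesis .
qed

text \<open>In the coordinates that diagonalize both blocks, the \<open>k\<close>-th column of \<open>Z\<close> has the entry \<open>\<surd>\<alpha>\<^sub>k\<close> in
position \<open>k\<close> and \<open>\<surd>\<beta>\<^sub>k\<close> in position \<open>p + k\<close>. Different columns have disjoint supports and hence are
orthogonal.\<close>

lemma sigma_max_gram:
  assumes S1: "S1 \<in> psd_mats p" and S2: "S2 \<in> psd_mats q"
    and dec1: "ordered_eigendecomp p S1 U1 L1" and dec2: "ordered_eigendecomp q S2 U2 L2"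
  obtains Z where "Z \<in> carrier_mat (p + q) (p + q)"
    "transpose_mat Z * Z = mat_diag (p + q) (\<lambda>k. diag_entries p L1 k + diag_entries q L2 k)"
    "Z * transpose_mat Z = sigma_max p q S1 S2 U1 L1 U2 L2"
proof
  note d1 = ordered_eigendecompD[OF S1 dec1] and d2 = ordered_eigendecompD[OF S2 dec2]
  define \<alpha> where "\<alpha> = diag_entries p L1"
  define \<beta> where "\<beta> = diag_entries q L2"
  have supp: "\<alpha> i = 0" if "\<not> i < p" for i using that by (simp add: \<alpha>_def diag_entries_def)
  have supp': "\<beta> i = 0" if "\<not> i < q" for i using that by (simp add: \<beta>_def diag_entries_def)
  have nonneg: "\<alpha> i \<ge> 0" "\<beta> i \<ge> 0" for i using d1(6) d2(6) by (auto simp: \<alpha>_def \<beta>_def)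
  define U where "U = four_block_mat U1 (0\<^sub>m p q) (0\<^sub>m q p) U2"
  define V where "V = mat (p + q) (p + q) (\<lambda>(i,k). if i < p
    then (if k = i then sqrt (\<alpha> k) else 0) else (if k = i - p then sqrt (\<beta> k) else 0))"
  define \<Phi> where "\<Phi> = mat p q (\<lambda>(i,j). if i = j then sqrt (\<alpha> i) * sqrt (\<beta> i) else 0)"
  have UT: "transpose_mat U = four_block_mat (transpose_mat U1) (0\<^sub>m p q) (0\<^sub>m q p) (transpose_mat U2)"
    unfolding U_def using d1(1) d2(1) by (subst transpose_four_block_mat[of _ p p _ q _ q]) auto
  have U: "U \<in> carrier_mat (p + q) (p + q)" using d1(1) d2(1) by (simp add: U_def)
  have V: "V \<in> carrier_mat (p + q) (p + q)" by (simp add: V_def)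
  have UU: "transpose_mat U * U = 1\<^sub>m (p + q)"
    unfolding UT unfolding U_def using d1(1,2) d2(1,2)
    by (subst mult_four_block_mat[of _ p p _ q _ q _ _ p _ q]) auto
  show "U * V \<in> carrier_mat (p + q) (p + q)" using U V by (intro carrier_matI) auto
  have VV: "transpose_mat V * V = mat_diag (p + q) (\<lambda>k. \<alpha> k + \<beta> k)"
  proof (rule eq_matI)
    fix k l assume "k < dim_row (mat_diag (p + q) (\<lambda>k. \<alpha> k + \<beta> k))"
      "l < dim_col (mat_diag (p + q) (\<lambda>k. \<alpha> k + \<beta> k))"
    then have kl: "k < p + q" "l < p + q" by simp_all
    have "(transpose_mat V * V) $$ (k,l) = (\<Sum>i<p + q. V $$ (i,k) * V $$ (i,l))"
      using kl V by (subst mult_mat_index) auto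
    also have "\<dots> = (\<Sum>i<p. if i = k then (if k = l then \<alpha> k else 0) else 0)
        + (\<Sum>i<q. if i = k then (if k = l then \<beta> k else 0) else 0)"
      unfolding sum_lessThan_add using kl nonneg
      by (intro arg_cong2[where f = "(+)"] sum.cong) (auto simp: V_def)
    also have "\<dots> = mat_diag (p + q) (\<lambda>k. \<alpha> k + \<beta> k) $$ (k,l)"
      using kl supp[of k] supp'[of k] by auto
    finally show "(transpose_mat V * V) $$ (k,l) = mat_diag (p + q) (\<lambda>k. \<alpha> k + \<beta> k) $$ (k,l)" .
  qed (simp_all add: V_def)
  show "transpose_mat (U * V) * (U * V)
      = mat_diag (p + q) (\<lambda>k. diag_entries p L1 k + diag_entries q L2 k)"
    using U V VV by (simp add: transpose_mult_dim mult_assoc_dim mult_cancel_mid[OF UU] \<alpha>_def \<beta>_def)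
  have VVT: "V * transpose_mat V
      = four_block_mat (mat_diag p \<alpha>) \<Phi> (transpose_mat \<Phi>) (mat_diag q \<beta>)" (is "_ = ?F")
  proof (rule eq_matI)
    fix i j assume "i < dim_row ?F" "j < dim_col ?F"
    then have ij: "i < p + q" "j < p + q" by simp_all
    have "(V * transpose_mat V) $$ (i,j) = (\<Sum>k<p + q. V $$ (i,k) * V $$ (j,k))"
      using ij V by (subst mult_mat_index) auto
    also have "\<dots> = (\<Sum>k<p + q. if k = (if i < p then i else i - p) then
        (if i < p then sqrt (\<alpha> k) else sqrt (\<beta> k)) * V $$ (j,k) else 0)"
      using ij by (intro sum.cong) (auto simp: V_def)
    also have "\<dots> = ?F $$ (i,j)"
      using ij nonneg by (auto simp: V_def \<Phi>_def)
    finally show "(V * transpose_mat V) $$ (i,j) = ?F $$ (i,j)" .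
  qed (simp_all add: V_def)
  have \<Phi>: "\<Phi> \<in> carrier_mat p q" by (simp add: \<Phi>_def)
  have psi: "psi_max p q U1 L1 U2 L2 = U1 * \<Phi> * transpose_mat U2"
    unfolding psi_max_eq[OF assms] \<Phi>_def \<alpha>_def \<beta>_def ..
  have "U * V * transpose_mat (U * V) = U * (V * transpose_mat V) * transpose_mat U"
    using U V by (simp add: transpose_mult_dim mult_assoc_dim)
  also have "\<dots> = four_block_mat (U1 * mat_diag p \<alpha> * transpose_mat U1) (U1 * \<Phi> * transpose_mat U2)
      (U2 * transpose_mat \<Phi> * transpose_mat U1) (U2 * mat_diag q \<beta> * transpose_mat U2)"
    unfolding VVT UT unfolding U_def using d1(1) d2(1) \<Phi>
    by (subst block_diag_mult_block_diag) auto
  also have "\<dots> = sigma_max p q S1 S2 U1 L1 U2 L2"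
    unfolding sigma_max_def psi d1(5)[symmetric, folded \<alpha>_def] d2(5)[symmetric, folded \<beta>_def]
    using d1(1) d2(1) \<Phi> by (simp add: transpose_mult_dim mult_assoc_dim)
  finally show "U * V * transpose_mat (U * V) = sigma_max p q S1 S2 U1 L1 U2 L2" .
qed

lemma sigma_max_attains:
  assumes S1: "S1 \<in> psd_mats p" and S2: "S2 \<in> psd_mats q"
    and dec1: "ordered_eigendecomp p S1 U1 L1" and dec2: "ordered_eigendecomp q S2 U2 L2"
  defines "\<sigma> \<equiv> \<lambda>k. diag_entries p L1 k + diag_entries q L2 k"
    and "S \<equiv> sigma_max p q S1 S2 U1 L1 U2 L2"
  shows "S \<in> block_couplings p q S1 S2"
    and "trace_mat (sqrt_mat S) = (\<Sum>k<p + q. sqrt (\<sigma> k))"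
    and "trace_mat (S * S) = (\<Sum>k<p + q. (\<sigma> k)\<^sup>2)"
proof -
  obtain Z where Z: "Z \<in> carrier_mat (p + q) (p + q)"
    and gram: "transpose_mat Z * Z = mat_diag (p + q) \<sigma>" and ZS: "Z * transpose_mat Z = S"
    using sigma_max_gram[OF assms(1-4)] unfolding \<sigma>_def S_def by blast
  show "trace_mat (sqrt_mat S) = (\<Sum>k<p + q. sqrt (\<sigma> k))"
    using trace_sqrt_gram[OF Z gram] unfolding ZS .
  show "S \<in> block_couplings p q S1 S2"
    using gram_psd[OF Z] psd_matsD(1)[OF S1] psd_matsD(1)[OF S2]
    unfolding ZS unfolding S_def sigma_max_def by (intro four_block_couplingI) auto
  have "S * S = Z * (transpose_mat Z * Z * transpose_mat Z)"
    unfolding ZS[symmetric] using Z by (simp add: mult_assoc_dim)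
  then have "trace_mat (S * S) = trace_mat (transpose_mat Z * Z * transpose_mat Z * Z)"
    using Z by (subst trace_mult_commute[of "transpose_mat Z * Z * transpose_mat Z" "p + q" "p + q"])
      (auto intro!: carrier_matI)
  also have "transpose_mat Z * Z * transpose_mat Z * Z = mat_diag (p + q) \<sigma> * mat_diag (p + q) \<sigma>"
    unfolding gram[symmetric] using Z by (simp add: mult_assoc_dim)
  also have "trace_mat \<dots> = (\<Sum>k<p + q. (\<sigma> k)\<^sup>2)"
    by (simp add: trace_mat_def power2_eq_square)
  finally show "trace_mat (S * S) = (\<Sum>k<p + q. (\<sigma> k)\<^sup>2)" .
qed

lemma sigma_max_minimizes_trace_sqrt:
  assumes "S1 \<in> psd_mats p" "S2 \<in> psd_mats q"
    "ordered_eigendecomp p S1 U1 L1" "ordered_eigendecomp q S2 U2 L2" "S \<in> block_couplings p q S1 S2"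
  shows "trace_mat (sqrt_mat (sigma_max p q S1 S2 U1 L1 U2 L2)) \<le> trace_mat (sqrt_mat S)"
  using coupling_bounds(1)[OF assms(5,1-4)] sigma_max_attains(2)[OF assms(1-4)] by simp

lemma sigma_max_maximizes_sq_cross_cov:
  assumes "S1 \<in> psd_mats p" "S2 \<in> psd_mats q"
    "ordered_eigendecomp p S1 U1 L1" "ordered_eigendecomp q S2 U2 L2" "S \<in> block_couplings p q S1 S2"
  shows "sq_cross_cov p S \<le> sq_cross_cov p (sigma_max p q S1 S2 U1 L1 U2 L2)"
  using coupling_bounds(2)[OF assms(5,1-4)] sigma_max_attains(3)[OF assms(1-4)]
    trace_coupling_square[OF assms(5)] trace_coupling_square[OF sigma_max_attains(1)[OF assms(1-4)]]
  by simp

section \<open>Bures--Wasserstein distances to the identity and to the independent coupling\<close>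

lemma bw_dist_sq_identity:
  assumes S: "S \<in> psd_mats n"
  shows "bw_dist_sq S (1\<^sub>m n) = trace_mat S + trace_mat (1\<^sub>m n) - 2 * trace_mat (sqrt_mat S)"
  using sqrt_mat_psd[OF S] psd_matsD(1)[OF sqrt_mat_psd(1)[OF S]] by (simp add: bw_dist_sq_def)

text \<open>For \<open>Q = S\<^sup>1\<^sup>/\<^sup>2\<close>, both \<open>Q (R R) Q\<close> and \<open>R S R\<close> are Gram matrices of \<open>R Q\<close>, so one may be
replaced by the other under the trace of the square root.\<close>

lemma bw_dist_sq_square:
  assumes S: "S \<in> psd_mats n" and R: "R \<in> carrier_mat n n" "transpose_mat R = R"
  shows "bw_dist_sq S (R * R)
    = trace_mat S + trace_mat (R * R) - 2 * trace_mat (sqrt_mat (R * S * R))"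
    and "R * S * R \<in> psd_mats n"
proof -
  define Q where "Q = sqrt_mat S"
  have Q: "Q \<in> carrier_mat n n" "transpose_mat Q = Q" "Q * Q = S"
    using sqrt_mat_psd[OF S] psd_matsD[OF sqrt_mat_psd(1)[OF S]] by (auto simp: Q_def)
  have X: "R * Q \<in> carrier_mat n n" using R Q by simp
  have "transpose_mat (R * Q) * (R * Q) = Q * (R * R) * Q"
    using R Q by (simp add: transpose_mult_dim mult_assoc_dim)
  moreover have XX: "R * Q * transpose_mat (R * Q) = R * S * R"
    unfolding Q(3)[symmetric] using R Q(1,2) by (simp add: transpose_mult_dim mult_assoc_dim)
  ultimately show "bw_dist_sq S (R * R)
    = trace_mat S + trace_mat (R * R) - 2 * trace_mat (sqrt_mat (R * S * R))"
    using trace_sqrt_swap[OF X] by (simp add: bw_dist_sq_def Q_def)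
  show "R * S * R \<in> psd_mats n" using gram_psd[OF X] unfolding XX .
qed

lemma sqrt_mat_eigendecomp:
  assumes A: "A \<in> psd_mats n" and dec: "ordered_eigendecomp n A U L"
  shows "sqrt_mat A = U * mat_diag n (\<lambda>k. sqrt (diag_entries n L k)) * transpose_mat U"
proof (rule sqrt_mat_eqI)
  note d = ordered_eigendecompD[OF A dec]
  show "U * mat_diag n (\<lambda>k. sqrt (diag_entries n L k)) * transpose_mat U \<in> psd_mats n"
    using d by (intro scaled_gram_psd) auto
  show "(U * mat_diag n (\<lambda>k. sqrt (diag_entries n L k)) * transpose_mat U)
      * (U * mat_diag n (\<lambda>k. sqrt (diag_entries n L k)) * transpose_mat U) = A"
    unfolding mult_scaled_isometry[OF d(1,2)] using d(5,6) by simp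
qed

lemma ordered_eigendecomp_square:
  assumes A: "A \<in> psd_mats n" and dec: "ordered_eigendecomp n A U L"
  shows "ordered_eigendecomp n (A * A) U (L * L)"
    and "diag_entries n (L * L) k = (diag_entries n L k)\<^sup>2"
proof -
  note d = ordered_eigendecompD[OF A dec]
  have LL: "L * L = mat_diag n (\<lambda>k. (diag_entries n L k)\<^sup>2)"
    by (subst (1 2) d(4)) (simp add: power2_eq_square)
  show "diag_entries n (L * L) k = (diag_entries n L k)\<^sup>2"
    unfolding LL by (auto simp: diag_entries_def)
  have "A * A = U * (L * L) * transpose_mat U"
    unfolding LL by (subst (1 2) d(5))
      (simp add: mult_scaled_isometry[OF d(1,2)] power2_eq_square del: mat_diag_diag)
  moreover have "sorted_wrt (\<ge>) (diag_mat (L * L))"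
    unfolding LL using d(6,7) by (auto simp: diag_mat_def sorted_wrt_iff_nth_less intro!: power_mono)
  ultimately show "ordered_eigendecomp n (A * A) U (L * L)"
    using d(1-3) by (auto simp: ordered_eigendecomp_def LL diagonal_mat_def)
qed

text \<open>In eigencoordinates the multiplication by the roots of the blocks turns \<open>\<surd>\<alpha>\<^sub>k \<surd>\<beta>\<^sub>k\<close> into
\<open>\<alpha>\<^sub>k \<beta>\<^sub>k\<close>, which is the corresponding entry for the squared blocks.\<close>

lemma psi_max_square:
  assumes S1: "S1 \<in> psd_mats p" and S2: "S2 \<in> psd_mats q"
    and dec1: "ordered_eigendecomp p S1 U1 L1" and dec2: "ordered_eigendecomp q S2 U2 L2"
  shows "sqrt_mat S1 * psi_max p q U1 L1 U2 L2 * sqrt_mat S2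
    = psi_max p q U1 (L1 * L1) U2 (L2 * L2)"
proof -
  note d1 = ordered_eigendecompD[OF S1 dec1] and d2 = ordered_eigendecompD[OF S2 dec2]
  have S11: "S1 * S1 \<in> psd_mats p" using gram_psd[of S1 p p] psd_matsD[OF S1] by simp
  have S22: "S2 * S2 \<in> psd_mats q" using gram_psd[of S2 q q] psd_matsD[OF S2] by simp
  define \<alpha> where "\<alpha> = diag_entries p L1"
  define \<beta> where "\<beta> = diag_entries q L2"
  have nonneg: "\<alpha> i \<ge> 0" "\<beta> i \<ge> 0" for i using d1(6) d2(6) by (auto simp: \<alpha>_def \<beta>_def)
  define \<Phi> where "\<Phi> = mat p q (\<lambda>(i,j). if i = j then sqrt (\<alpha> i) * sqrt (\<beta> i) else 0)"
  have \<Phi>: "\<Phi> \<in> carrier_mat p q" by (simp add: \<Phi>_def)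
  have roots: "sqrt (\<alpha> i) * (sqrt (\<alpha> i) * sqrt (\<beta> i)) * sqrt (\<beta> i) = \<alpha> i * \<beta> i" for i
  proof -
    have "sqrt (\<alpha> i) * (sqrt (\<alpha> i) * sqrt (\<beta> i)) * sqrt (\<beta> i)
        = (sqrt (\<alpha> i) * sqrt (\<alpha> i)) * (sqrt (\<beta> i) * sqrt (\<beta> i))"
      by (simp only: mult.assoc)
    then show ?thesis using nonneg by simp
  qed
  have "sqrt_mat S1 * psi_max p q U1 L1 U2 L2 * sqrt_mat S2
      = U1 * (mat_diag p (\<lambda>k. sqrt (\<alpha> k)) * \<Phi> * mat_diag q (\<lambda>k. sqrt (\<beta> k))) * transpose_mat U2"
    unfolding psi_max_eq[OF assms] sqrt_mat_eigendecomp[OF S1 dec1] sqrt_mat_eigendecomp[OF S2 dec2]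
      \<alpha>_def[symmetric] \<beta>_def[symmetric] \<Phi>_def[symmetric]
    using d1(1) d2(1) \<Phi>
    by (simp add: mult_assoc_dim mult_cancel_mid[OF d1(2)] mult_cancel_mid[OF d2(2)])
  also have "mat_diag p (\<lambda>k. sqrt (\<alpha> k)) * \<Phi> * mat_diag q (\<lambda>k. sqrt (\<beta> k))
      = mat p q (\<lambda>(i,j). if i = j then sqrt ((\<alpha> i)\<^sup>2) * sqrt ((\<beta> i)\<^sup>2) else 0)"
    unfolding mat_diag_mult_left[OF \<Phi>] using nonneg
    by (subst mat_diag_mult_right[of _ p q]) (auto simp: \<Phi>_def roots intro!: eq_matI)
  finally show ?thesis
    unfolding psi_max_eq[OF S11 S22 ordered_eigendecomp_square(1)[OF S1 dec1]
        ordered_eigendecomp_square(1)[OF S2 dec2]]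
      ordered_eigendecomp_square(2)[OF S1 dec1] ordered_eigendecomp_square(2)[OF S2 dec2]
      \<alpha>_def[symmetric] \<beta>_def[symmetric] .
qed

text \<open>Conjugation by the root of the independent coupling sends couplings of \<open>S1\<close> and \<open>S2\<close> to couplings of
\<open>S1\<^sup>2\<close> and \<open>S2\<^sup>2\<close>, because \<open>S1\<^sup>1\<^sup>/\<^sup>2 S1 S1\<^sup>1\<^sup>/\<^sup>2 = S1\<^sup>2\<close>.\<close>

lemma congruence_with_root_blocks:
  assumes S: "S \<in> block_couplings p q S1 S2" and S1: "S1 \<in> psd_mats p" and S2: "S2 \<in> psd_mats q"
  defines "R \<equiv> four_block_mat (sqrt_mat S1) (0\<^sub>m p q) (0\<^sub>m q p) (sqrt_mat S2)"
  shows "R * S * R = four_block_mat (S1 * S1) (sqrt_mat S1 * upper_right p p S * sqrt_mat S2)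
      (sqrt_mat S2 * transpose_mat (upper_right p p S) * sqrt_mat S1) (S2 * S2)"
    and "R * R = four_block_mat S1 (0\<^sub>m p q) (0\<^sub>m q p) S2"
    and "R \<in> carrier_mat (p + q) (p + q)" and "transpose_mat R = R"
proof -
  note r1 = psd_matsD[OF sqrt_mat_psd(1)[OF S1]] and r2 = psd_matsD[OF sqrt_mat_psd(1)[OF S2]]
  note q1 = sqrt_mat_psd(2)[OF S1] and q2 = sqrt_mat_psd(2)[OF S2]
  define \<Psi> where "\<Psi> = upper_right p p S"
  note S' = couplingD[OF S, folded \<Psi>_def]
  show "R \<in> carrier_mat (p + q) (p + q)" using r1 r2 by (simp add: R_def)
  show "transpose_mat R = R"
    unfolding R_def using r1 r2 by (subst transpose_four_block_mat[of _ p p _ q _ q]) auto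
  show "R * R = four_block_mat S1 (0\<^sub>m p q) (0\<^sub>m q p) S2"
    unfolding R_def using r1(1) r2(1) S'(2,3) q1 q2
    by (subst mult_four_block_mat[of _ p p _ q _ q _ _ p _ q]) auto
  have "sqrt_mat S1 * (sqrt_mat S1 * sqrt_mat S1) * sqrt_mat S1
      = (sqrt_mat S1 * sqrt_mat S1) * (sqrt_mat S1 * sqrt_mat S1)"
    using r1(3,4) by (simp add: mult_assoc_dim del: q1)
  then have e1: "sqrt_mat S1 * S1 * sqrt_mat S1 = S1 * S1" unfolding q1 .
  have "sqrt_mat S2 * (sqrt_mat S2 * sqrt_mat S2) * sqrt_mat S2
      = (sqrt_mat S2 * sqrt_mat S2) * (sqrt_mat S2 * sqrt_mat S2)"
    using r2(3,4) by (simp add: mult_assoc_dim)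
  then have e2: "sqrt_mat S2 * S2 * sqrt_mat S2 = S2 * S2" unfolding q2 .
  show "R * S * R = four_block_mat (S1 * S1) (sqrt_mat S1 * upper_right p p S * sqrt_mat S2)
      (sqrt_mat S2 * transpose_mat (upper_right p p S) * sqrt_mat S1) (S2 * S2)"
    unfolding R_def \<Psi>_def[symmetric]
    by (subst S'(5), subst block_diag_mult_block_diag) (use S'(2-4) r1(1) r2(1) e1 e2 in auto)
qed

lemma sigma_max_congruence:
  assumes S1: "S1 \<in> psd_mats p" and S2: "S2 \<in> psd_mats q"
    and dec1: "ordered_eigendecomp p S1 U1 L1" and dec2: "ordered_eigendecomp q S2 U2 L2"
  defines "R \<equiv> four_block_mat (sqrt_mat S1) (0\<^sub>m p q) (0\<^sub>m q p) (sqrt_mat S2)"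
  shows "R * sigma_max p q S1 S2 U1 L1 U2 L2 * R
    = sigma_max p q (S1 * S1) (S2 * S2) U1 (L1 * L1) U2 (L2 * L2)"
proof -
  note sm = sigma_max_attains(1)[OF assms(1-4)]
  note r1 = psd_matsD[OF sqrt_mat_psd(1)[OF S1]] and r2 = psd_matsD[OF sqrt_mat_psd(1)[OF S2]]
  let ?\<Psi> = "psi_max p q U1 L1 U2 L2"
  have \<Psi>: "?\<Psi> \<in> carrier_mat p q"
    unfolding psi_max_eq[OF assms(1-4)]
    using ordered_eigendecompD(1)[OF S1 dec1] ordered_eigendecompD(1)[OF S2 dec2]
    by (intro carrier_matI) auto
  have ur: "upper_right p p (sigma_max p q S1 S2 U1 L1 U2 L2) = ?\<Psi>"
    unfolding sigma_max_def using psd_matsD(1)[OF S1] psd_matsD(1)[OF S2] \<Psi>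
    by (intro upper_right_four_block) auto
  have "sqrt_mat S2 * transpose_mat ?\<Psi> * sqrt_mat S1
      = transpose_mat (sqrt_mat S1 * ?\<Psi> * sqrt_mat S2)"
    using \<Psi> r1(2-4) r2(2-4) by (simp add: transpose_mult_dim mult_assoc_dim)
  then show ?thesis
    unfolding R_def congruence_with_root_blocks(1)[OF sm S1 S2] ur
    by (simp add: psi_max_square[OF assms(1-4)] sigma_max_def)
qed

theorem proposition3p9:
  fixes p q :: nat and S1 S2 U1 L1 U2 L2 :: "real mat"
  assumes "p \<ge> 1" and "q \<ge> 1"
    and "S1 \<in> psd_mats p" and "S2 \<in> psd_mats q"
    and "ordered_eigendecomp p S1 U1 L1" and "ordered_eigendecomp q S2 U2 L2"
  shows
    "is_arg_max (\<lambda>S. bw_dist S (1\<^sub>m (p + q))) (\<lambda>S. S \<in> block_couplings p q S1 S2)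
       (sigma_max p q S1 S2 U1 L1 U2 L2)
     \<and> is_arg_max (\<lambda>S. bw_dist S (four_block_mat S1 (0\<^sub>m p q) (0\<^sub>m q p) S2))
       (\<lambda>S. S \<in> block_couplings p q S1 S2) (sigma_max p q S1 S2 U1 L1 U2 L2)
     \<and> is_arg_max (sq_cross_cov p) (\<lambda>S. S \<in> block_couplings p q S1 S2)
       (sigma_max p q S1 S2 U1 L1 U2 L2)
     \<and> (S1 \<noteq> 0\<^sub>m p p \<and> S2 \<noteq> 0\<^sub>m q q \<longrightarrow>
         is_arg_max (RV_coeff p) (\<lambda>S. S \<in> block_couplings p q S1 S2)
           (sigma_max p q S1 S2 U1 L1 U2 L2))"
proof -
  note decs = assms(3-6)
  define M where "M = sigma_max p q S1 S2 U1 L1 U2 L2"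
  define R where "R = four_block_mat (sqrt_mat S1) (0\<^sub>m p q) (0\<^sub>m q p) (sqrt_mat S2)"
  have M: "M \<in> block_couplings p q S1 S2" unfolding M_def by (rule sigma_max_attains(1)[OF decs])
  have trace: "trace_mat S = trace_mat S1 + trace_mat S2" if "S \<in> block_couplings p q S1 S2" for S
    using couplingD[OF that] trace_four_block by metis
  have i: "bw_dist S (1\<^sub>m (p + q)) \<le> bw_dist M (1\<^sub>m (p + q))"
    if S: "S \<in> block_couplings p q S1 S2" for S
    unfolding bw_dist_def bw_dist_sq_identity[OF couplingD(1)[OF S]]
      bw_dist_sq_identity[OF couplingD(1)[OF M]]
    using sigma_max_minimizes_trace_sqrt[OF decs S] trace[OF S] trace[OF M]
    by (simp add: M_def)
  have ii: "bw_dist S (four_block_mat S1 (0\<^sub>m p q) (0\<^sub>m q p) S2)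
      \<le> bw_dist M (four_block_mat S1 (0\<^sub>m p q) (0\<^sub>m q p) S2)"
    if S: "S \<in> block_couplings p q S1 S2" for S
  proof -
    note cong = congruence_with_root_blocks[OF S decs(1,2), folded R_def]
    have sq: "S1 * S1 \<in> psd_mats p" "S2 * S2 \<in> psd_mats q"
      using gram_psd[of S1 p p] gram_psd[of S2 q q] psd_matsD[OF decs(1)] psd_matsD[OF decs(2)]
      by auto
    have "R * S * R \<in> block_couplings p q (S1 * S1) (S2 * S2)"
      using bw_dist_sq_square(2)[OF couplingD(1)[OF S] cong(3,4)] sq psd_matsD(1)
      unfolding cong(1) by (intro four_block_couplingI) auto
    from sigma_max_minimizes_trace_sqrt[OF sq ordered_eigendecomp_square(1)[OF decs(1,3)]
        ordered_eigendecomp_square(1)[OF decs(2,4)] this]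
    have "trace_mat (sqrt_mat (R * M * R)) \<le> trace_mat (sqrt_mat (R * S * R))"
      unfolding M_def R_def sigma_max_congruence[OF decs] .
    then show ?thesis
      unfolding cong(2)[symmetric] bw_dist_def
        bw_dist_sq_square(1)[OF couplingD(1)[OF S] cong(3,4)]
        bw_dist_sq_square(1)[OF couplingD(1)[OF M] cong(3,4)]
      using trace[OF S] trace[OF M] by simp
  qed
  have iii: "sq_cross_cov p S \<le> sq_cross_cov p M" if "S \<in> block_couplings p q S1 S2" for S
    unfolding M_def by (rule sigma_max_maximizes_sq_cross_cov[OF decs that])
  have RV: "RV_coeff p S = sq_cross_cov p S / sqrt (trace_mat (S1 ^\<^sub>m 2) * trace_mat (S2 ^\<^sub>m 2))"
    if "S \<in> block_couplings p q S1 S2" for S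
    using that by (simp add: RV_coeff_def block_couplings_def)
  have iv: "RV_coeff p S \<le> RV_coeff p M" if S: "S \<in> block_couplings p q S1 S2" for S
  proof -
    have tr: "trace_mat (A ^\<^sub>m 2) \<ge> 0" if A: "A \<in> psd_mats n" for A n
    proof -
      note A' = psd_matsD[OF A]
      have "trace_mat (A ^\<^sub>m 2) = trace_mat (A * transpose_mat A)"
        using A'(1,2) by (simp add: numeral_2_eq_2)
      also have "\<dots> = (\<Sum>i<n. \<Sum>j<n. (A $$ (i,j))\<^sup>2)"
        using A'(1) by (subst trace_mult[of _ n n]) (auto simp: power2_eq_square)
      also have "\<dots> \<ge> 0" by (intro sum_nonneg) auto
      finally show ?thesis .
    qed
    show ?thesis unfolding RV[OF S] RV[OF M]
      using iii[OF S] tr[OF decs(1)] tr[OF decs(2)] by (intro divide_right_mono) auto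
  qed
  show ?thesis
    unfolding M_def[symmetric] is_arg_max_def using M i ii iii iv by (auto simp: not_less)
qed

end
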